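(* Let $\mathbf T$ be a troupe. Let $f_1,\ldots,f_r$ be insertion-additive tree statistics, and let $x_1,\ldots,x_r$ be variables; work over the field $\mathbb K=\mathbb C(x_1,\ldots,x_r)$. If $(\kappa_n)_{n\geq 1}$ is the sequence of free cumulants defined by \[\kappa_n=-\sum_{T\in\mathbf T_{n-1}}x_1^{f_1(T)}\cdots x_r^{f_r(T)},\] then the corresponding sequence $(c_n)_{n\geq 1}$ of classical cumulants is given by \[c_n=-\sum_{\mathcal T\in\overline{\mathsf D}\mathbf T_{n-1}}x_1^{\ddot f_1(\mathcal T)}\cdots x_r^{\ddot f_r(\mathcal T)}.\]
   Context: Cumulants. $\Pi(n)$ is the set of set partitions of $[n]=\{1,\ldots,n\}$, and $\mathrm{NC}(n)$ is the set of those that are noncrossing (there are no distinct blocks $B,B'$ and $i,j\in B$, $i',j'\in B'$ with $i<i'<j<j'$ or $i>i'>j>j'$). For a sequence $(u_n)_{n\ge1}$ in a field and a set partition $\rho$, put $(u_\bullet)_\rho=\prod_{B\in\rho}u_{|B|}$. A sequence $(\kappa_n)$ of free cumulants and a sequence $(c_n)$ of classical cumulants correspond to each other if they have the same moment sequence $(m_n)_{n\ge1}$, i.e. $m_n=\sum_{\rho\in\Pi(n)}(c_\bullet)_\rho=\sum_{\eta\in\mathrm{NC}(n)}(\kappa_\bullet)_\eta$ for all $n\ge1$. Each sequence determines the others. Trees and troupes. Fix a finite set $\mathbf C$ of colors containing black and white. A binary plane tree is a finite (possibly empty) rooted tree in which every vertex has at most two children, every child is designated as either a left child or a right child (not both),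 and no vertex has two left children or two right children. A colored binary plane tree is a binary plane tree together with a function from its vertex set to $\mathbf C$; trees are considered up to isomorphism, and $\mathsf{CBPT}$ is the set of colored binary plane trees. $\mathbf T_n$ is the set of trees in $\mathbf T$ with $n$ vertices. Insertion: for nonempty $T_1,T_2\in\mathsf{CBPT}$ and a vertex $v$ of $T_1$, replace $v$ by two vertices joined by a left edge: the lower one is still called $v$ (it keeps the color and the left/right subtrees of $v$), and the upper one $v^*$ is black, takes the place of $v$ with respect to the parent of $v$ (if any), and has $v$ as left child; then attach $T_2$ as the right subtree of $v^*$. The result is $\nabla_v(T_1,T_2)$. Decomposition: if $v^*$ is a black vertex with $2$ children in $T$, let $v$ be its left child and $T_2$ its right subtree; delete $T_2$ and contract the edge $vv^*$ to a single vertex identified with $v$ (with the color of $v$), giving $T_1$; then $\Delta_{v^*}(T)=(T_1,T_2)$. A troupe is a set $\mathbf T\subseteq\mathsf{CBPT}$ such that: (i) $\nabla_v(T_1,T_2)\in\mathbf T$ for all nonempty $T_1,T_2\in\mathbf T$ and all vertices $v$ of $T_1$; (ii) $\Delta_{v^*}(T)\in\mathbf T\times\mathbf T$ for every $T\in\mathbf T$ and every black vertex $v^*$ of $T$ with $2$ children; (iii) for every $T\in\mathbf T$, all vertices of $T$ with $2$ children are black. Statistics. A tree statistic is a function $f:\mathsf{CBPT}\to\mathbb C$; it is insertion-additive if $f(\nabla_v(T_1,T_2))=f(T_1)+f(T_2)$ for all nonempty $T_1,T_2\in\mathsf{CBPT}$ and all vertices $v$ of $T_1$. Decreasing trees. A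 decreasing colored binary plane tree is a colored binary plane tree whose vertices are bijectively labeled by a finite set of positive integers such that each nonroot vertex has a smaller label than its parent; $\mathrm{skel}(\mathcal T)$ is the tree obtained by removing labels, and $\ddot f(\mathcal T)=f(\mathrm{skel}(\mathcal T))$. $\overline{\mathsf D}\mathbf T_n$ is the set of decreasing colored binary plane trees with $n$ vertices, with label set $[n]$, and with skeleton in $\mathbf T$. *)

theory Defs
  imports
    Complex_Main
    "HOL-Library.Tree"
    "HOL-Library.Poly_Mapping"
    "HOL-Library.Disjoint_Sets"
    "HOL-Library.FuncSet"
    "HOL-Computational_Algebra.Fraction_Field"
begin

section \<open>Cumulants\<close>

text \<open>Sequences \<open>(u\<^sub>n)\<close> with \<open>n \<ge> 1\<close> are functions on \<^typ>\<open>nat\<close> whose value at \<open>0\<close> is never used.\<close>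

definition set_partitions :: "nat \<Rightarrow> nat set set set" where
  "set_partitions n = {\<rho>. partition_on {1..n} \<rho>}"

definition noncrossing :: "nat set set \<Rightarrow> bool" where
  "noncrossing \<rho> \<longleftrightarrow>
     \<not> (\<exists>B\<in>\<rho>. \<exists>B'\<in>\<rho>. B \<noteq> B' \<and>
          (\<exists>i\<in>B. \<exists>j\<in>B. \<exists>i'\<in>B'. \<exists>j'\<in>B'.
             (i < i' \<and> i' < j \<and> j < j') \<or> (i > i' \<and> i' > j \<and> j > j')))"

definition NC :: "nat \<Rightarrow> nat set set set" where
  "NC n = {\<eta> \<in> set_partitions n. noncrossing \<eta>}"

definition part_prod :: "(nat \<Rightarrow> 'a::field) \<Rightarrow> nat set set \<Rightarrow> 'a" where
  "part_prod u \<rho> = (\<Prod>B\<in>\<rho>. u (card B))"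

definition cumulants_correspond :: "(nat \<Rightarrow> 'a::field) \<Rightarrow> (nat \<Rightarrow> 'a) \<Rightarrow> bool" where
  "cumulants_correspond \<kappa> c \<longleftrightarrow>
     (\<exists>m. \<forall>n\<ge>1. m n = (\<Sum>\<rho>\<in>set_partitions n. part_prod c \<rho>) \<and>
                m n = (\<Sum>\<eta>\<in>NC n. part_prod \<kappa> \<eta>))"


section \<open>Colored binary plane trees and troupes\<close>

text \<open>
  Isomorphism classes of colored binary plane trees with colors in \<open>'c\<close> are the elements of
  \<^typ>\<open>'c tree\<close>: \<^const>\<open>Leaf\<close> is the empty tree, each \<^const>\<open>Node\<close> is a colored vertex, a
  \<^const>\<open>Leaf\<close> below a node is an absent child, and \<^const>\<open>size\<close> counts vertices. A vertex is
  addressed by the path leading to it from the root.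
\<close>

datatype dir = Lft | Rgt

fun subtree_at :: "dir list \<Rightarrow> 'a tree \<Rightarrow> 'a tree" where
  "subtree_at [] t = t"
| "subtree_at (d # p) Leaf = Leaf"
| "subtree_at (Lft # p) (Node l x r) = subtree_at p l"
| "subtree_at (Rgt # p) (Node l x r) = subtree_at p r"

fun replace_at :: "dir list \<Rightarrow> 'a tree \<Rightarrow> 'a tree \<Rightarrow> 'a tree" where
  "replace_at [] t s = s"
| "replace_at (d # p) Leaf s = Leaf"
| "replace_at (Lft # p) (Node l x r) s = Node (replace_at p l s) x r"
| "replace_at (Rgt # p) (Node l x r) s = Node l x (replace_at p r s)"

definition vertices :: "'a tree \<Rightarrow> dir list set" where
  "vertices t = {p. subtree_at p t \<noteq> Leaf}"

definition two_children :: "'a tree \<Rightarrow> dir list \<Rightarrow> bool" where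
  "two_children t v \<longleftrightarrow> left (subtree_at v t) \<noteq> Leaf \<and> right (subtree_at v t) \<noteq> Leaf"

definition color_at :: "'a tree \<Rightarrow> dir list \<Rightarrow> 'a" where
  "color_at t v = value (subtree_at v t)"

text \<open>
  The new vertex \<open>v\<^sup>*\<close> takes over the address of \<open>v\<close>. The old vertex \<open>v\<close>, together with everything
  below it, becomes the left subtree of \<open>v\<^sup>*\<close>.
\<close>

definition insertion :: "'c \<Rightarrow> dir list \<Rightarrow> 'c tree \<Rightarrow> 'c tree \<Rightarrow> 'c tree" where
  "insertion black v T1 T2 = replace_at v T1 (Node (subtree_at v T1) black T2)"

text \<open>
  Deleting the right subtree of \<open>v\<^sup>*\<close> and contracting the edge from \<open>v\<^sup>*\<close> to its left child \<open>v\<close>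
  puts the subtree rooted at \<open>v\<close> in the place of \<open>v\<^sup>*\<close>.
\<close>

definition decomposition :: "dir list \<Rightarrow> 'c tree \<Rightarrow> 'c tree \<times> 'c tree" where
  "decomposition v T = (replace_at v T (left (subtree_at v T)), right (subtree_at v T))"

definition troupe :: "'c \<Rightarrow> 'c tree set \<Rightarrow> bool" where
  "troupe black TT \<longleftrightarrow>
     (\<forall>T1\<in>TT. \<forall>T2\<in>TT. T1 \<noteq> Leaf \<longrightarrow> T2 \<noteq> Leaf \<longrightarrow>
        (\<forall>v\<in>vertices T1. insertion black v T1 T2 \<in> TT)) \<and>
     (\<forall>T\<in>TT. \<forall>v\<in>vertices T. two_children T v \<longrightarrow> color_at T v = black \<longrightarrow>
        decomposition v T \<in> TT \<times> TT) \<and>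
     (\<forall>T\<in>TT. \<forall>v\<in>vertices T. two_children T v \<longrightarrow> color_at T v = black)"

definition trees_of_size :: "'c tree set \<Rightarrow> nat \<Rightarrow> 'c tree set" where
  "trees_of_size TT n = {T \<in> TT. size T = n}"

definition insertion_additive :: "'c \<Rightarrow> ('c tree \<Rightarrow> complex) \<Rightarrow> bool" where
  "insertion_additive black f \<longleftrightarrow>
     (\<forall>T1 T2. T1 \<noteq> Leaf \<longrightarrow> T2 \<noteq> Leaf \<longrightarrow>
        (\<forall>v\<in>vertices T1. f (insertion black v T1 T2) = f T1 + f T2))"


section \<open>Decreasing trees\<close>

text \<open>Each vertex of a labeled tree carries the pair of its color and its label.\<close>

definition skel :: "('c \<times> nat) tree \<Rightarrow> 'c tree" where
  "skel = map_tree fst"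

definition labels :: "('c \<times> nat) tree \<Rightarrow> nat set" where
  "labels t = snd ` set_tree t"

fun root_less :: "('c \<times> nat) tree \<Rightarrow> nat \<Rightarrow> bool" where
  "root_less Leaf k = True"
| "root_less (Node l x r) k = (snd x < k)"

fun children_less :: "('c \<times> nat) tree \<Rightarrow> bool" where
  "children_less Leaf = True"
| "children_less (Node l x r) =
     (root_less l (snd x) \<and> root_less r (snd x) \<and> children_less l \<and> children_less r)"

definition decreasing_tree :: "('c \<times> nat) tree \<Rightarrow> bool" where
  "decreasing_tree t \<longleftrightarrow>
     distinct (map snd (inorder t)) \<and> 0 \<notin> labels t \<and> children_less t"

definition decreasing_trees_of_size :: "'c tree set \<Rightarrow> nat \<Rightarrow> ('c \<times> nat) tree set" where
  "decreasing_trees_of_size TT n =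
     {t. decreasing_tree t \<and> size t = n \<and> labels t = {1..n} \<and> skel t \<in> TT}"


section \<open>Rational functions with complex exponents\<close>

text \<open>
  Tree statistics are complex-valued, so \<open>x\<^sub>1\<^bsup>f\<^sub>1(T)\<^esup> \<cdots> x\<^sub>r\<^bsup>f\<^sub>r(T)\<^esup>\<close> is in general not a
  rational function of \<open>x\<^sub>1, \<dots>, x\<^sub>r\<close>. We work in the extension field of \<open>\<complex>(x\<^sub>1, x\<^sub>2, \<dots>)\<close> obtained by
  adjoining the formal powers \<open>x\<^sub>i\<^bsup>a\<^esup>\<close> with \<open>a \<in> \<complex>\<close>, that is, the fraction field of the group algebra
  over \<open>\<complex>\<close> of the group of finitely supported exponent vectors with complex entries. For integers
  \<open>a\<close>, the formal power \<open>x\<^sub>i\<^bsup>a\<^esup>\<close> is the ordinary power of the variable \<open>x\<^sub>i\<close>, so integer-valued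
  statistics give elements of the subfield \<open>\<complex>(x\<^sub>1, \<dots>, x\<^sub>r)\<close>.

  The type \<open>cexp\<close> is the additive group \<open>\<complex>\<close>. It is a copy of its own only because the library proves
  that the group algebra is a domain from a linear order on the exponents; the (lexicographic) order
  has no other role.
\<close>

typedef cexp = "UNIV :: complex set"
  morphisms complex_of_cexp cexp_of_complex ..

setup_lifting type_definition_cexp

instantiation cexp :: linordered_ab_group_add
begin

lift_definition zero_cexp :: cexp is 0 .
lift_definition plus_cexp :: "cexp \<Rightarrow> cexp \<Rightarrow> cexp" is "(+)" .
lift_definition minus_cexp :: "cexp \<Rightarrow> cexp \<Rightarrow> cexp" is "(-)" .
lift_definition uminus_cexp :: "cexp \<Rightarrow> cexp" is uminus .
lift_definition less_eq_cexp :: "cexp \<Rightarrow> cexp \<Rightarrow> bool"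
  is "\<lambda>a b. Re a < Re b \<or> Re a = Re b \<and> Im a \<le> Im b" .
lift_definition less_cexp :: "cexp \<Rightarrow> cexp \<Rightarrow> bool"
  is "\<lambda>a b. Re a < Re b \<or> Re a = Re b \<and> Im a < Im b" .

instance
  by standard (transfer; force simp: complex_eq_iff)+

end

type_synonym ratfun = "((nat \<Rightarrow>\<^sub>0 cexp) \<Rightarrow>\<^sub>0 complex) fract"

definition xpow :: "nat \<Rightarrow> complex \<Rightarrow> ratfun" where
  "xpow i a = Fract (Poly_Mapping.single (Poly_Mapping.single i (cexp_of_complex a)) 1) 1"

abbreviation xvar :: "nat \<Rightarrow> ratfun" where
  "xvar i \<equiv> xpow i 1"

definition ratconst :: "complex \<Rightarrow> ratfun" where
  "ratconst z = Fract (Poly_Mapping.single 0 z) 1"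

lemma xpow_0 [simp]: "xpow i 0 = 1"
  by (simp add: xpow_def One_fract_def flip: zero_cexp_def)

lemma xpow_add: "xpow i (a + b) = xpow i a * xpow i b"
  by (simp add: xpow_def mult_single plus_cexp.abs_eq eq_onp_same_args flip: single_add)

lemma xpow_nonzero [simp]: "xpow i a \<noteq> 0"
  using xpow_add[of i a "- a"] by auto

lemma xpow_of_nat: "xpow i (of_nat n) = xvar i ^ n"
  by (induction n) (simp_all add: xpow_add)

lemma xpow_of_int: "xpow i (of_int k) = xvar i powi k"
proof (cases "k \<ge> 0")
  case True
  then show ?thesis
    using xpow_of_nat[of i "nat k"] by (simp add: power_int_def)
next
  case False
  have "xpow i (of_int k) * xpow i (of_nat (nat (- k))) = 1"
    using False by (simp flip: xpow_add)
  then have "xpow i (of_int k) = inverse (xvar i ^ nat (- k))"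
    by (metis inverse_unique mult.commute xpow_of_nat inverse_inverse_eq)
  with False show ?thesis
    by (simp add: power_int_def power_inverse)
qed

text \<open>
  The power products are linearly independent over \<open>\<complex>\<close>; in particular, the variables \<^term>\<open>xvar i\<close>
  are algebraically independent.
\<close>

lemma xpow_linear_independent:
  assumes "finite I" "finite A" "A \<subseteq> I \<rightarrow>\<^sub>E UNIV"
    and "(\<Sum>a\<in>A. ratconst (z a) * (\<Prod>i\<in>I. xpow i (a i))) = 0"
    and "a \<in> A"
  shows "z a = 0"
proof -
  define e where "e = (\<lambda>a::nat \<Rightarrow> complex. \<Sum>i\<in>I. Poly_Mapping.single i (cexp_of_complex (a i)))"
  have prod: "(\<Prod>i\<in>J. xpow i (a i)) =
      Fract (Poly_Mapping.single (\<Sum>i\<in>J. Poly_Mapping.single i (cexp_of_complex (a i))) 1) 1"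
    if "finite J" for J and a :: "nat \<Rightarrow> complex"
    using that by induction (simp_all add: xpow_def mult_single One_fract_def)
  have sum: "(\<Sum>a\<in>B. Fract (Poly_Mapping.single (e a) (z a)) 1) =
      Fract (\<Sum>a\<in>B. Poly_Mapping.single (e a) (z a)) 1" if "finite B" for B
    using that by induction (simp_all add: Zero_fract_def)
  have e: "Poly_Mapping.lookup (e a) j = (if j \<in> I then cexp_of_complex (a j) else 0)" for a j
  proof -
    have "Poly_Mapping.lookup (e a) j = (\<Sum>i\<in>I. if i = j then cexp_of_complex (a i) else 0)"
      by (simp add: e_def Poly_Mapping.lookup_sum lookup_single when_def)
    then show ?thesis
      using assms(1) by simp
  qed
  have inj: "a = b" if "a \<in> A" "b \<in> A" "e a = e b" for a b
  proof (rule PiE_ext)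
    show "a \<in> I \<rightarrow>\<^sub>E UNIV" "b \<in> I \<rightarrow>\<^sub>E UNIV"
      using that assms(3) by auto
    show "a i = b i" if "i \<in> I" for i
      using e[of a i] e[of b i] \<open>e a = e b\<close> that by (simp add: cexp_of_complex_inject)
  qed
  have "(\<Sum>a\<in>A. Fract (Poly_Mapping.single (e a) (z a)) 1) = 0"
    using assms(4) by (simp add: ratconst_def prod[OF assms(1)] mult_single e_def)
  then have "(\<Sum>a\<in>A. Poly_Mapping.single (e a) (z a)) = 0"
    by (simp add: sum[OF assms(2)] Zero_fract_def eq_fract)
  then have "0 = Poly_Mapping.lookup (\<Sum>a\<in>A. Poly_Mapping.single (e a) (z a)) (e a)"
    by simp
  also have "\<dots> = (\<Sum>b\<in>A. if b = a then z b else 0)"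
    unfolding Poly_Mapping.lookup_sum using inj[OF _ assms(5)]
    by (intro sum.cong) (auto simp: lookup_single when_def)
  also have "\<dots> = z a"
    using assms(2,5) by simp
  finally show ?thesis
    by simp
qed

end

theory Submission
  imports Defs "HOL-Computational_Algebra.Formal_Power_Series"
begin

text \<open>
  Let \<open>w T\<close> be the monomial of \<open>T\<close> if \<open>T\<close> lies in the troupe, and \<open>0\<close> otherwise. The troupe axioms and
  insertion-additivity turn into one property: \<open>w\<close> is multiplicative under insertion and vanishes on
  trees that have a vertex with two children that is not black
  (\<open>troupe_weight_right_multiplicative\<close>). A decreasing tree is a tree with a decreasing labeling, so
  both cumulant sequences are sums of \<open>w\<close> over all trees of a given size, in the classical case
  weighted by the number of decreasing labelings.

  The sequences correspond because both give the same moments. Cutting a tree at the root expresses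
  its weight by those of its subtrees: two children give a product \<open>w L * w R\<close>, and a single child
  gives the weight \<open>\<alpha> T = w (Node T x Leaf)\<close> or \<open>\<alpha> T = w (Node Leaf x T)\<close>, which is multiplicative in
  the sense \<open>\<alpha> (insertion b v T1 T2) = \<alpha> T1 * w T2\<close>. The argument therefore treats all such \<open>\<alpha>\<close> at
  once. Let \<open>D \<alpha>\<close> be the exponential generating function of nonempty decreasing trees and
  \<open>K \<alpha>\<close> the ordinary generating function of nonempty trees, with weight \<open>\<alpha>\<close>. Both satisfy a quadratic
  equation with a term \<open>D \<alpha> * D w\<close> or \<open>K \<alpha> * K w\<close> (\<open>tree_sum_Suc\<close>).

  The exponential moment series \<open>m\<close> of the classical cumulants satisfies \<open>m' = - (w Leaf + D w) * m\<close>,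
  and the ordinary moment series \<open>M\<close> of the free cumulants satisfies
  \<open>M = 1 - z * M * (w Leaf + K w (z * M))\<close> (\<open>free_moment_fps\<close>). These relations cancel the quadratic
  terms: the coefficients of \<open>D \<alpha> * m\<close> and those of \<open>M * K \<alpha> (z * M)\<close> obey the same linear
  recursion (\<open>labeling_convolution_recursion\<close>, \<open>tree_fps_compose_recursion\<close>), coupled in the same way to
  the coefficients of \<open>m\<close> and of \<open>M\<close>. Induction identifies the moments
  (\<open>moments_of_multiplicative_weight\<close>). Since moments determine classical cumulants, this proves both
  directions of the claim.
\<close>

unbundle fps_syntax

section \<open>Moments from classical cumulants\<close>

definition partition_sum :: "(nat \<Rightarrow> 'a::field) \<Rightarrow> nat set \<Rightarrow> 'a" where
  "partition_sum u S = (\<Sum>P | partition_on S P. part_prod u P)"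

fun classical_moment :: "(nat \<Rightarrow> 'a::field) \<Rightarrow> nat \<Rightarrow> 'a" where
  "classical_moment u 0 = 1"
| "classical_moment u (Suc n) =
     (\<Sum>k\<le>n. of_nat (n choose k) * u (Suc k) * classical_moment u (n - k))"

text \<open>
  A partition of \<open>insert x S\<close> is the block containing \<open>x\<close>, written \<open>insert x A\<close>, together with a
  partition of the remaining points \<open>S - A\<close>.
\<close>

lemma partition_sum_insert:
  assumes "finite S" "x \<notin> S"
  shows "partition_sum u (insert x S) = (\<Sum>A\<in>Pow S. u (Suc (card A)) * partition_sum u (S - A))"
proof -
  let ?I = "SIGMA A:Pow S. {Q. partition_on (S - A) Q}"
  let ?j = "\<lambda>(A, Q). insert (insert x A) Q"
  have fin: "finite {Q. partition_on (S - A) Q}" for A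
    using assms(1) by (intro finitely_many_partition_on) auto
  have inS: "x \<notin> B" if "partition_on (S - A) Q" "B \<in> Q" for A Q B
    using that assms(2) by (auto simp: partition_on_def)
  have "bij_betw ?j ?I {P. partition_on (insert x S) P}"
  proof (rule bij_betwI')
    fix y z assume "y \<in> ?I" "z \<in> ?I"
    moreover obtain A Q A' Q' where "y = (A, Q)" "z = (A', Q')" by fastforce
    ultimately show "?j y = ?j z \<longleftrightarrow> y = z"
    proof -
      assume *: "y \<in> ?I" "z \<in> ?I" "y = (A, Q)" "z = (A', Q')"
      \<comment> \<open>the blocks of \<open>Q\<close> are those avoiding \<open>x\<close>, so the joined partition determines both parts\<close>
      have "A = A' \<and> Q = Q'" if eq: "insert (insert x A) Q = insert (insert x A') Q'"
      proof -
        have Q: "Q = {B \<in> insert (insert x A) Q. x \<notin> B}" "Q' = {B \<in> insert (insert x A') Q'. x \<notin> B}"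
          using * inS by auto
        have "insert x A = insert x A'"
          using * eq inS by (metis (no_types, lifting) insert_iff mem_Sigma_iff mem_Collect_eq)
        moreover have "x \<notin> A" "x \<notin> A'" using * assms(2) by auto
        ultimately have "A = A'" by (metis insert_ident)
        with Q eq show ?thesis by metis
      qed
      with * show ?thesis by auto
    qed
  next
    fix y assume "y \<in> ?I"
    then obtain A Q where y: "y = (A, Q)" and A: "A \<subseteq> S" and Q: "partition_on (S - A) Q" by auto
    have "partition_on (insert x S) (insert (insert x A) Q)"
      using A Q assms(2) unfolding partition_on_def
      by (auto simp: disjoint_def)
    then show "?j y \<in> {P. partition_on (insert x S) P}" by (simp add: y)
  next
    fix P assume "P \<in> {P. partition_on (insert x S) P}"
    then have P: "partition_on (insert x S) P" by simp
    then obtain B where B: "B \<in> P" "x \<in> B" by (auto simp: partition_on_def)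
    have "partition_on (insert x S - B) (P - {B})"
      using P B unfolding partition_on_def disjoint_def by blast
    moreover have "insert x S - B = S - (B - {x})" using B assms(2) by auto
    moreover have "B - {x} \<subseteq> S" using P B by (auto simp: partition_on_def)
    ultimately have "(B - {x}, P - {B}) \<in> ?I" by simp
    moreover have "?j (B - {x}, P - {B}) = P" using B by (auto simp: insert_absorb)
    ultimately show "\<exists>y\<in>?I. P = ?j y" by metis
  qed
  then have "partition_sum u (insert x S) = (\<Sum>y\<in>?I. part_prod u (?j y))"
    unfolding partition_sum_def by (simp add: sum.reindex_bij_betw)
  also have "\<dots> = (\<Sum>(A, Q)\<in>?I. u (Suc (card A)) * part_prod u Q)"
  proof (intro sum.cong refl)
    fix y assume "y \<in> ?I"
    then obtain A Q where y: "y = (A, Q)" and A: "A \<in> Pow S" and Q: "partition_on (S - A) Q"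
      by auto
    have "finite A" "x \<notin> A" using A assms finite_subset by auto
    moreover have "finite Q" using finite_elements[OF _ Q] assms(1) by simp
    moreover have "insert x A \<notin> Q" using inS[OF Q] by auto
    ultimately show "part_prod u (?j y) = (case y of (A, Q) \<Rightarrow> u (Suc (card A)) * part_prod u Q)"
      by (simp add: part_prod_def y)
  qed
  also have "\<dots> = (\<Sum>A\<in>Pow S. u (Suc (card A)) * partition_sum u (S - A))"
    unfolding partition_sum_def sum_distrib_left
    using assms(1) fin by (subst sum.Sigma) auto
  finally show ?thesis .
qed

lemma sum_over_subsets_by_card:
  assumes "finite S"
  shows "(\<Sum>A\<in>Pow S. g (card A)) = (\<Sum>k\<le>card S. of_nat (card S choose k) * (g k :: 'a::comm_semiring_1))"
proof -
  have "(\<Sum>A\<in>Pow S. g (card A)) = (\<Sum>k\<le>card S. \<Sum>A | A \<in> Pow S \<and> card A = k. g (card A))"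
    using assms by (intro sum.group[symmetric]) (auto intro: card_mono)
  also have "\<dots> = (\<Sum>k\<le>card S. of_nat (card S choose k) * g k)"
    using n_subsets[OF assms] by (intro sum.cong) auto
  finally show ?thesis .
qed

text \<open>
  The recursion for the sum over partitions depends on \<open>S\<close> only through its size, which spares any
  transport along bijections between carrier sets.
\<close>

lemma partition_sum_eq_classical_moment:
  "finite S \<Longrightarrow> partition_sum u S = classical_moment u (card S)"
proof (induction "card S" arbitrary: S rule: less_induct)
  case less
  show ?case
  proof (cases "S = {}")
    case True
    have "{P. partition_on {} P} = {{}::nat set set}"
      by (auto simp: partition_on_def)
    with True show ?thesis by (simp add: partition_sum_def part_prod_def)
  next
    case False
    then obtain x R where S: "S = insert x R" "x \<notin> R" by (meson mk_disjoint_insert ex_in_conv)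
    have R: "finite R" using less.prems S by simp
    have "partition_sum u S = (\<Sum>A\<in>Pow R. u (Suc (card A)) * classical_moment u (card R - card A))"
      unfolding S(1) partition_sum_insert[OF R S(2)]
    proof (intro sum.cong refl)
      fix A assume "A \<in> Pow R"
      then have "card (R - A) = card R - card A" "card (R - A) < card S"
        using R S by (auto simp: card_Diff_subset finite_subset le_imp_less_Suc)
      with less.hyps[of "R - A"] R
      show "u (Suc (card A)) * partition_sum u (R - A) = u (Suc (card A)) * classical_moment u (card R - card A)"
        by simp
    qed
    also have "\<dots> = classical_moment u (card S)"
      using R S sum_over_subsets_by_card[OF R, of "\<lambda>k. u (Suc k) * classical_moment u (card R - k)"]
      by (simp add: mult.assoc)
    finally show ?thesis .
  qed
qed

lemma sum_set_partitions: "(\<Sum>\<rho>\<in>set_partitions n. part_prod u \<rho>) = classical_moment u n"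
  using partition_sum_eq_classical_moment[of "{1..n}" u]
  by (simp add: partition_sum_def set_partitions_def)

lemma classical_moment_cong:
  "(\<And>k. u (Suc k) = v (Suc k)) \<Longrightarrow> classical_moment u n = classical_moment v n"
  by (induction n rule: less_induct) (case_tac x; simp)

text \<open>
  The cumulant of index \<open>n + 1\<close> enters the moment of index \<open>n + 1\<close> with coefficient \<open>1\<close> and
  otherwise only cumulants of smaller index occur, so the moments determine the cumulants.
\<close>

lemma classical_moment_inject:
  assumes "\<And>n. classical_moment u n = classical_moment v n"
  shows "u (Suc n) = v (Suc n)"
proof (induction n rule: less_induct)
  case (less n)
  have split: "classical_moment t (Suc n) =
      (\<Sum>k<n. of_nat (n choose k) * t (Suc k) * classical_moment t (n - k)) + t (Suc n)" for t :: "nat \<Rightarrow> 'a"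
    by (simp add: lessThan_Suc_atMost[symmetric])
  have "(\<Sum>k<n. of_nat (n choose k) * u (Suc k) * classical_moment u (n - k)) =
      (\<Sum>k<n. of_nat (n choose k) * v (Suc k) * classical_moment v (n - k))"
    using less assms by (intro sum.cong) auto
  then show ?case
    using assms[of "Suc n"] split[of u] split[of v] by simp
qed


section \<open>Moments from free cumulants\<close>

lemma noncrossingI:
  assumes "\<And>B B' i j i' j'. \<lbrakk>B \<in> P; B' \<in> P; i \<in> B; j \<in> B; i' \<in> B'; j' \<in> B';
      i < i'; i' < j; j < j'\<rbrakk> \<Longrightarrow> B = B'"
  shows "noncrossing P"
  unfolding noncrossing_def
proof (intro notI, elim bexE conjE disjE)
  fix B B' i j i' j'
  assume B: "B \<in> P" "B' \<in> P" "B \<noteq> B'" "i \<in> B" "j \<in> B" "i' \<in> B'" "j' \<in> B'"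
  show False if "i < i'" "i' < j" "j < j'"
    using assms[OF B(1,2,4-7) that] B(3) by simp
  show False if "i > i'" "i' > j" "j > j'"
    using assms[OF B(2,1,7,6,5,4) that(3,2,1)] B(3) by simp
qed

lemma noncrossingD:
  assumes "noncrossing P" "B \<in> P" "B' \<in> P" "i \<in> B" "j \<in> B" "i' \<in> B'" "j' \<in> B'"
    "i < i'" "i' < j" "j < j'"
  shows "B = B'"
proof (rule ccontr)
  assume "B \<noteq> B'"
  moreover have "(i < i' \<and> i' < j \<and> j < j') \<or> (i > i' \<and> i' > j \<and> j > j')"
    using assms(8-10) by simp
  ultimately have "\<exists>B\<in>P. \<exists>B'\<in>P. B \<noteq> B' \<and> (\<exists>i\<in>B. \<exists>j\<in>B. \<exists>i'\<in>B'. \<exists>j'\<in>B'.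
      (i < i' \<and> i' < j \<and> j < j') \<or> (i > i' \<and> i' > j \<and> j > j'))"
    by (intro bexI[of _ B] bexI[of _ B'] conjI bexI[of _ i] bexI[of _ j] bexI[of _ i'] bexI[of _ j'] assms)
  with assms(1) show False unfolding noncrossing_def by (rule notE)
qed

lemma noncrossing_subset:
  assumes "noncrossing P" "P' \<subseteq> P"
  shows "noncrossing P'"
proof (rule noncrossingI)
  fix B B' i j i' j'
  assume B: "B \<in> P'" "B' \<in> P'" "i \<in> B" "j \<in> B" "i' \<in> B'" "j' \<in> B'" "i < i'" "i' < j" "j < j'"
  with assms(2) have "B \<in> P" "B' \<in> P" by auto
  then show "B = B'" by (rule noncrossingD[OF assms(1) _ _ B(3-9)])
qed

definition nc_partitions :: "nat set \<Rightarrow> nat set set set" where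
  "nc_partitions S = {P. partition_on S P \<and> noncrossing P}"

lemma finite_nc_partitions [simp]: "finite S \<Longrightarrow> finite (nc_partitions S)"
  unfolding nc_partitions_def by (rule finite_subset[OF _ finitely_many_partition_on]) auto

lemma nc_partition_finite: "P \<in> nc_partitions S \<Longrightarrow> finite S \<Longrightarrow> finite P"
  using finite_elements[of S P] by (simp add: nc_partitions_def)

lemma nc_partitionsD:
  assumes "P \<in> nc_partitions S"
  shows "\<Union>P = S" "disjoint P" "{} \<notin> P" "noncrossing P"
    and "B \<in> P \<Longrightarrow> B \<subseteq> S" "B \<in> P \<Longrightarrow> B \<noteq> {}"
  using assms by (auto simp: nc_partitions_def partition_on_def)

text \<open>
  Let \<open>a\<close> be the first point of an interval and let \<open>b\<close> be the next point of its block. In a noncrossing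
  partition no block can join a point strictly between \<open>a\<close> and \<open>b\<close> to a point outside. Hence the
  points between them carry a noncrossing partition \<open>Q\<close> of their own, and removing \<open>a\<close> from the rest
  leaves a noncrossing partition \<open>R\<close> of the points from \<open>b\<close> on. The following operation is the
  inverse of this splitting.
\<close>

definition nc_join :: "nat \<Rightarrow> nat \<Rightarrow> nat set set \<Rightarrow> nat set set \<Rightarrow> nat set set" where
  "nc_join a b Q R = Q \<union> (\<lambda>B. if b \<in> B then insert a B else B) ` R"

lemma nc_join_in_nc_partitions:
  assumes ab: "a < b" and bc: "b < c"
    and Q: "Q \<in> nc_partitions {Suc a..<b}" and R: "R \<in> nc_partitions {b..<c}"
  shows "nc_join a b Q R \<in> nc_partitions {a..<c}"
proof -
  define g where "g = (\<lambda>B. if b \<in> B then insert a B else B)"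
  have Qp: "\<Union>Q = {Suc a..<b}" "disjoint Q" "{} \<notin> Q" and Qn: "noncrossing Q"
    and Rp: "\<Union>R = {b..<c}" "disjoint R" "{} \<notin> R" and Rn: "noncrossing R"
    using Q R by (auto simp: nc_partitions_def partition_on_def)
  have Q_range: "a < y" "y < b" if "B \<in> Q" "y \<in> B" for B y
    using nc_partitionsD(5)[OF Q that(1)] that(2) by auto
  have R_range: "b \<le> y" "y < c" if "B \<in> R" "y \<in> B" for B y
    using nc_partitionsD(5)[OF R that(1)] that(2) by auto
  have g: "y \<in> g B \<longleftrightarrow> y \<in> B \<or> (y = a \<and> b \<in> B)" for y B
    by (auto simp: g_def)
  have same: "B = B'" if "B \<in> R" "B' \<in> R" "y \<in> B" "y \<in> B'" for B B' y
    using that Rp(2) by (auto simp: disjoint_def)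
  have join: "nc_join a b Q R = Q \<union> g ` R" by (simp add: nc_join_def g_def)
  have "\<Union>(nc_join a b Q R) = {a..<c}"
  proof -
    have "\<Union>(g ` R) = insert a {b..<c}"
    proof
      show "\<Union>(g ` R) \<subseteq> insert a {b..<c}" using R_range by (force simp: g)
      have "b \<in> \<Union>R" unfolding Rp(1) using bc by simp
      then show "insert a {b..<c} \<subseteq> \<Union>(g ` R)" unfolding Rp(1)[symmetric] by (auto simp: g)
    qed
    then have "\<Union>(nc_join a b Q R) = {Suc a..<b} \<union> insert a {b..<c}"
      by (simp only: join Union_Un_distrib Qp(1))
    then show ?thesis using ab bc by auto
  qed
  moreover have "disjoint (nc_join a b Q R)"
  proof -
    have RR: "g B \<inter> g B' = {}" if "B \<in> R" "B' \<in> R" "g B \<noteq> g B'" for B B'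
    proof -
      have "B \<noteq> B'" using that by blast
      then show ?thesis
        using same[OF that(1,2)] R_range[OF that(1), of a] R_range[OF that(2), of a] ab by (auto simp: g)
    qed
    have QR: "B \<inter> g B' = {}" if "B \<in> Q" "B' \<in> R" for B B'
      using Q_range[OF that(1)] R_range[OF that(2)] by (force simp: g)
    show ?thesis
    proof (intro disjointI)
      fix X Y assume X: "X \<in> nc_join a b Q R" and Y: "Y \<in> nc_join a b Q R" and "X \<noteq> Y"
      have "X \<in> Q \<or> (\<exists>B\<in>R. X = g B)" "Y \<in> Q \<or> (\<exists>B\<in>R. Y = g B)"
        using X Y unfolding join by blast+
      with \<open>X \<noteq> Y\<close> show "X \<inter> Y = {}"
        using disjointD[OF Qp(2), of X Y] RR QR by (metis Int_commute)
    qed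
  qed
  moreover have "{} \<notin> nc_join a b Q R"
    using Qp(3) Rp(3) by (auto simp: nc_join_def split: if_splits)
  moreover have "noncrossing (nc_join a b Q R)"
  proof (rule noncrossingI)
    fix B B' i j i' j'
    assume B: "B \<in> nc_join a b Q R" "B' \<in> nc_join a b Q R" "i \<in> B" "j \<in> B" "i' \<in> B'" "j' \<in> B'"
      and less: "i < i'" "i' < j" "j < j'"
    consider "B \<in> Q" "B' \<in> Q" | X' where "B \<in> Q" "X' \<in> R" "B' = g X'"
      | X where "X \<in> R" "B = g X" "B' \<in> Q" | X X' where "X \<in> R" "B = g X" "X' \<in> R" "B' = g X'"
      using B(1,2) unfolding join by blast
    then show "B = B'"
    proof cases
      case 1
      then show ?thesis using noncrossingD[OF Qn _ _ B(3-6) less] by simp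
    next
      case 2
      have "a < i" "j < b" using Q_range 2 B by auto
      moreover have "i' = a \<or> b \<le> i'" using R_range[OF 2(2)] B(5) 2(3) by (auto simp: g)
      ultimately show ?thesis using less by linarith
    next
      case 3
      have "a < i'" "j' < b" using Q_range 3 B by auto
      moreover have "j = a \<or> b \<le> j" using R_range[OF 3(1)] B(4) 3(2) by (auto simp: g)
      ultimately show ?thesis using less by linarith
    next
      case 4
      have ge: "i = a \<or> b \<le> i" using R_range[OF 4(1)] B(3) 4(2) by (auto simp: g)
      \<comment> \<open>only the smallest of the four points can be \<open>a\<close>; if it is, then \<open>b\<close> replaces it as a witness of a crossing in \<open>R\<close>\<close>
      with less ab have "i' \<noteq> a" "j \<noteq> a" "j' \<noteq> a" by auto
      with B 4 have in': "j \<in> X" "i' \<in> X'" "j' \<in> X'" by (auto simp: g)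
      have "X = X'"
      proof (cases "i = a")
        case True
        have "a \<notin> X" using R_range[OF 4(1), of a] ab by auto
        with True B 4 have bX: "b \<in> X" by (auto simp: g)
        have "b \<le> i'" using in' R_range 4 by blast
        then consider "b = i'" | "b < i'" by linarith
        then show ?thesis
        proof cases
          case 1
          then show ?thesis using same[OF 4(1,3)] bX in' by simp
        next
          case 2
          then show ?thesis by (rule noncrossingD[OF Rn 4(1,3) bX in' _ less(2,3)])
        qed
      next
        case False
        with B 4 have "i \<in> X" by (auto simp: g)
        then show ?thesis by (rule noncrossingD[OF Rn 4(1,3) _ in' less])
      qed
      with 4 show ?thesis by simp
    qed
  qed
  ultimately show ?thesis by (simp add: nc_partitions_def partition_on_def)
qed

text \<open>
  The next three lemmas recover \<open>Q\<close>, \<open>R\<close> and \<open>b\<close> from the joined partition, which gives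
  injectivity.
\<close>

lemma nc_join_left_part:
  assumes "a < b"
    and Q: "Q \<in> nc_partitions {Suc a..<b}" and R: "R \<in> nc_partitions {b..<c}"
  shows "{B \<in> nc_join a b Q R. B \<subseteq> {Suc a..<b}} = Q"
proof -
  have "\<not> (if b \<in> B then insert a B else B) \<subseteq> {Suc a..<b}" if B: "B \<in> R" for B
  proof -
    obtain y where "y \<in> B" "y \<in> {b..<c}" using nc_partitionsD(5,6)[OF R B] by blast
    then have "y \<in> (if b \<in> B then insert a B else B)" "y \<notin> {Suc a..<b}" by auto
    then show ?thesis by blast
  qed
  moreover have "B \<subseteq> {Suc a..<b}" if "B \<in> Q" for B
    by (rule nc_partitionsD(5)[OF Q that])
  ultimately show ?thesis unfolding nc_join_def by blast
qed

lemma nc_join_right_part: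
  assumes "a < b"
    and Q: "Q \<in> nc_partitions {Suc a..<b}" and R: "R \<in> nc_partitions {b..<c}"
  shows "(\<lambda>B. B - {a}) ` (nc_join a b Q R - Q) = R"
proof -
  define g where "g = (\<lambda>B. if b \<in> B then insert a B else B)"
  have notQ: "(if b \<in> B then insert a B else B) \<notin> Q" if B: "B \<in> R" for B
  proof -
    obtain y where "y \<in> B" "y \<in> {b..<c}" using nc_partitionsD(5,6)[OF R B] by blast
    then have "y \<in> (if b \<in> B then insert a B else B)" "y \<notin> {Suc a..<b}" by auto
    then show ?thesis using nc_partitionsD(5)[OF Q] by blast
  qed
  have "nc_join a b Q R - Q = g ` R"
    using notQ unfolding nc_join_def g_def by blast
  moreover have "(\<lambda>B. g B - {a}) ` R = (\<lambda>B. B) ` R"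
  proof (rule image_cong)
    fix B assume "B \<in> R"
    then show "g B - {a} = B"
      using nc_partitionsD(5)[OF R, of B] assms(1) by (auto simp: g_def)
  qed simp
  ultimately show ?thesis by (simp add: image_image)
qed

lemma nc_join_next:
  assumes "a < b" "b < c"
    and Q: "Q \<in> nc_partitions {Suc a..<b}" and R: "R \<in> nc_partitions {b..<c}"
  shows "Min {y. y \<noteq> a \<and> (\<exists>B\<in>nc_join a b Q R. a \<in> B \<and> y \<in> B)} = b"
proof (rule Min_eqI)
  have R': "\<Union>R = {b..<c}" by (rule nc_partitionsD(1)[OF R])
  let ?Y = "{y. y \<noteq> a \<and> (\<exists>B\<in>nc_join a b Q R. a \<in> B \<and> y \<in> B)}"
  have Y: "b \<le> y \<and> y < c" if y: "y \<in> ?Y" for y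
  proof -
    obtain B where B: "y \<noteq> a" "B \<in> nc_join a b Q R" "a \<in> B" "y \<in> B" using y by blast
    have "B \<notin> Q" using B(3) nc_partitionsD(5)[OF Q, of B] subsetD[of B "{Suc a..<b}" a] by auto
    with B obtain X where "X \<in> R" "y \<in> X" by (auto simp: nc_join_def split: if_splits)
    then have "y \<in> {b..<c}" using R' by blast
    then show ?thesis by simp
  qed
  show "y \<ge> b" if "y \<in> ?Y" for y using Y[OF that] by simp
  show "finite ?Y"
    by (rule finite_subset[of _ "{b..<c}"]) (use Y in force, simp)
  obtain X where "X \<in> R" "b \<in> X" using R' assms(2) by (metis Union_iff atLeastLessThan_iff order_refl)
  then have "insert a X \<in> nc_join a b Q R" by (force simp: nc_join_def)
  with \<open>b \<in> X\<close> assms(1) show "b \<in> ?Y" by blast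
qed

text \<open>
  Cutting off the first point \<open>a\<close> when its block has a further element: \<open>b\<close> is the least such
  element, \<open>Q\<close> collects the blocks lying strictly between \<open>a\<close> and \<open>b\<close>, and \<open>R\<close> arises from the
  other blocks by removing \<open>a\<close>.
\<close>

lemma nc_join_surj:
  assumes P: "P \<in> nc_partitions {a..<c}" and a: "a < c" "{a} \<notin> P"
  obtains b Q R where "a < b" "b < c" "Q \<in> nc_partitions {Suc a..<b}" "R \<in> nc_partitions {b..<c}"
    "P = nc_join a b Q R"
proof -
  have Pp: "\<Union>P = {a..<c}" "disjoint P" "{} \<notin> P" and Pn: "noncrossing P"
    using P by (auto simp: nc_partitions_def partition_on_def)
  have same: "B = B'" if "B \<in> P" "B' \<in> P" "y \<in> B" "y \<in> B'" for B B' y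
    using that Pp(2) by (auto simp: disjoint_def)
  have range: "a \<le> y" "y < c" if "B \<in> P" "y \<in> B" for B y
    using nc_partitionsD(5)[OF P that(1)] that(2) by auto
  have "a \<in> \<Union>P" using Pp(1) a by simp
  then obtain A where A: "A \<in> P" "a \<in> A" by blast
  define b where "b = Min (A - {a})"
  have finA: "finite A"
    by (rule finite_subset[of _ "{a..<c}"]) (use range[OF A(1)] in auto)
  have "A - {a} \<noteq> {}" using A a(2) by (metis Diff_eq_empty_iff subset_singletonD Pp(3))
  then have b: "b \<in> A" "b \<noteq> a" using Min_in[of "A - {a}"] finA by (auto simp: b_def)
  have b_least: "b \<le> y" if "y \<in> A" "y \<noteq> a" for y
    using Min_le[of "A - {a}" y] finA that by (simp add: b_def)
  have bac: "a < b" "b < c" using range[OF A(1) b(1)] b(2) by auto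
  define Q where "Q = {B \<in> P. B \<subseteq> {Suc a..<b}}"
  define R where "R = (\<lambda>B. B - {a}) ` (P - Q)"
  have notQ: "(B = A \<or> B \<subseteq> {b<..<c}) \<and> B \<noteq> {}" if B: "B \<in> P" "B \<notin> Q" for B
  proof (cases "B = A")
    case True
    then show ?thesis using A by auto
  next
    case False
    then have ab: "a \<notin> B" "b \<notin> B" using same A b B by auto
    obtain z where z: "z \<in> B" "z \<notin> {Suc a..<b}"
      using B unfolding Q_def by blast
    moreover have "z \<noteq> a" "z \<noteq> b" using ab z by auto
    ultimately have bz: "b < z" using range[OF B(1) z(1)] by auto
    have "b < y" if y: "y \<in> B" for y
    proof (rule ccontr)
      assume "\<not> b < y"
      with y ab range[OF B(1) y] have "a < y" "y < b" by (auto simp: order.strict_iff_order)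
      \<comment> \<open>otherwise \<open>a < y < b < z\<close> is a crossing of \<open>A\<close> and \<open>B\<close>\<close>
      then have "A = B" using noncrossingD[OF Pn A(1) B(1) A(2) b(1) y z(1) _ _ bz] by simp
      with False show False by simp
    qed
    then show ?thesis using range[OF B(1)] z(1) by auto
  qed
  have AQ: "A \<notin> Q" using A by (auto simp: Q_def)
  have UQ: "\<Union>Q = {Suc a..<b}"
  proof
    show "\<Union>Q \<subseteq> {Suc a..<b}" by (auto simp: Q_def)
    show "{Suc a..<b} \<subseteq> \<Union>Q"
    proof
      fix y assume y: "y \<in> {Suc a..<b}"
      then have "y \<in> \<Union>P" using Pp(1) bac by simp
      then obtain B where B: "B \<in> P" "y \<in> B" by blast
      have "B \<noteq> A" using B y b_least[of y] by auto
      moreover have "\<not> B \<subseteq> {b<..<c}" using B y by auto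
      ultimately show "y \<in> \<Union>Q" using notQ[of B] B by blast
    qed
  qed
  have Q: "Q \<in> nc_partitions {Suc a..<b}"
  proof -
    have "Q \<subseteq> P" by (auto simp: Q_def)
    then show ?thesis
      using UQ Pp(3) noncrossing_subset[OF Pn] pairwise_subset[OF Pp(2)]
      by (auto simp: nc_partitions_def partition_on_def)
  qed
  have UR: "\<Union>R = {b..<c}"
  proof
    show "\<Union>R \<subseteq> {b..<c}"
    proof
      fix y assume "y \<in> \<Union>R"
      then obtain B where B: "B \<in> P" "B \<notin> Q" "y \<in> B" "y \<noteq> a" by (auto simp: R_def)
      then show "y \<in> {b..<c}" using notQ[OF B(1,2)] b_least[of y] range[OF A(1), of y] by auto
    qed
    show "{b..<c} \<subseteq> \<Union>R"
    proof
      fix y assume y: "y \<in> {b..<c}"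
      then have "y \<in> \<Union>P" using Pp(1) bac by simp
      then obtain B where B: "B \<in> P" "y \<in> B" by blast
      with y have "B \<notin> Q" by (auto simp: Q_def)
      with B y bac show "y \<in> \<Union>R" by (auto simp: R_def)
    qed
  qed
  have "{} \<notin> R"
  proof
    assume "{} \<in> R"
    then obtain B where B: "B \<in> P" "B \<notin> Q" "B \<subseteq> {a}" by (auto simp: R_def)
    then have "b \<notin> B" "B \<inter> {b<..<c} = {}" using b(2) bac by auto
    then show False using notQ[OF B(1,2)] b(1) by blast
  qed
  moreover have "disjoint R"
  proof (rule disjointI)
    fix X X' assume "X \<in> R" "X' \<in> R" "X \<noteq> X'"
    then show "X \<inter> X' = {}" using same by (auto simp: R_def)
  qed
  moreover have "noncrossing R"
  proof (rule noncrossingI)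
    fix X X' i j i' j'
    assume X: "X \<in> R" "X' \<in> R" "i \<in> X" "j \<in> X" "i' \<in> X'" "j' \<in> X'" "i < i'" "i' < j" "j < j'"
    obtain B B' where B: "B \<in> P" "X = B - {a}" "B' \<in> P" "X' = B' - {a}"
      using X(1,2) by (auto simp: R_def)
    have "B = B'" using noncrossingD[OF Pn B(1,3), of i j i' j'] X B by simp
    with B show "X = X'" by simp
  qed
  ultimately have R: "R \<in> nc_partitions {b..<c}"
    using UR by (simp add: nc_partitions_def partition_on_def)
  have restore: "(if b \<in> B - {a} then insert a (B - {a}) else B - {a}) = B" if "B \<in> P - Q" for B
  proof (cases "B = A")
    case True
    then show ?thesis using A b by auto
  next
    case False
    then have "B \<subseteq> {b<..<c}" using notQ that by blast
    then show ?thesis using bac by auto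
  qed
  have "P = nc_join a b Q R"
  proof -
    have "(\<lambda>B. if b \<in> B then insert a B else B) ` R = P - Q"
      unfolding R_def image_image using restore by simp
    then show ?thesis by (auto simp: nc_join_def Q_def)
  qed
  with bac Q R show ?thesis using that by blast
qed

text \<open>
  The splitting moves \<open>a\<close> out of its block while the weight of that block must still count it. The
  parameter \<open>s\<close> remembers how many points have been removed from the block of the current first
  point.
\<close>

definition nc_sum :: "(nat \<Rightarrow> 'a::field) \<Rightarrow> nat \<Rightarrow> nat \<Rightarrow> nat \<Rightarrow> 'a" where
  "nc_sum u s a n = (\<Sum>P\<in>nc_partitions {a..<a + n}. \<Prod>B\<in>P. u (card B + (if a \<in> B then s else 0)))"

lemma nc_partitions_singleton:
  assumes "a < c"
  shows "{P \<in> nc_partitions {a..<c}. {a} \<in> P} = insert {a} ` nc_partitions {Suc a..<c}"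
proof (intro equalityI subsetI)
  fix P assume "P \<in> {P \<in> nc_partitions {a..<c}. {a} \<in> P}"
  then have P: "partition_on {a..<c} P" "noncrossing P" "{a} \<in> P" by (auto simp: nc_partitions_def)
  have "a \<notin> B" if "B \<in> P" "B \<noteq> {a}" for B
    using disjointD[OF partition_onD2[OF P(1)] P(3) that(1)] that(2) by auto
  then have "disjnt {a} (\<Union>(P - {{a}}))"
    by (auto simp: disjnt_def)
  from partition_on_insert[OF this, of "{a..<c}"]
  have "partition_on ({a..<c} - {a}) (P - {{a}})"
    using P by (simp add: insert_absorb)
  moreover have "{a..<c} - {a} = {Suc a..<c}" by auto
  moreover have "noncrossing (P - {{a}})" by (rule noncrossing_subset[OF P(2)]) blast
  ultimately have "P - {{a}} \<in> nc_partitions {Suc a..<c}" by (simp add: nc_partitions_def)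
  moreover have "P = insert {a} (P - {{a}})" using P(3) by blast
  ultimately show "P \<in> insert {a} ` nc_partitions {Suc a..<c}" by blast
next
  fix P assume "P \<in> insert {a} ` nc_partitions {Suc a..<c}"
  then obtain Q where Q: "P = insert {a} Q" "partition_on {Suc a..<c} Q" "noncrossing Q"
    by (auto simp: nc_partitions_def)
  have "disjnt {a} (\<Union>Q)" using Q(2) by (auto simp: partition_on_def disjnt_def)
  moreover have "{a..<c} - {a} = {Suc a..<c}" by auto
  ultimately have "partition_on {a..<c} P"
    using Q assms by (simp add: partition_on_insert)
  moreover have "noncrossing P"
  proof (rule noncrossingI)
    fix B B' i j i' j'
    assume B: "B \<in> P" "B' \<in> P" "i \<in> B" "j \<in> B" "i' \<in> B'" "j' \<in> B'" "i < i'" "i' < j" "j < j'"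
    have "B \<noteq> {a}" "B' \<noteq> {a}" using B by auto
    with B Q(1) have "B \<in> Q" "B' \<in> Q" by simp_all
    then show "B = B'" by (rule noncrossingD[OF Q(3) _ _ B(3-9)])
  qed
  ultimately show "P \<in> {P \<in> nc_partitions {a..<c}. {a} \<in> P}"
    using Q by (simp add: nc_partitions_def)
qed

lemma prod_nc_join:
  assumes "a < b"
    and Q: "Q \<in> nc_partitions {Suc a..<b}" and R: "R \<in> nc_partitions {b..<c}"
  shows "(\<Prod>B\<in>nc_join a b Q R. u (card B + (if a \<in> B then s else 0))) =
    (\<Prod>B\<in>Q. u (card B)) * (\<Prod>B\<in>R. u (card B + (if b \<in> B then Suc s else 0)))"
proof -
  define g where "g = (\<lambda>B. if b \<in> B then insert a B else B)"
  have fin: "finite Q" "finite R"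
    using nc_partition_finite[OF Q] nc_partition_finite[OF R] by simp_all
  have aR: "a \<notin> B" "finite B" if "B \<in> R" for B
  proof -
    have "B \<subseteq> {b..<c}" by (rule nc_partitionsD(5)[OF R that])
    then show "a \<notin> B" "finite B" using assms(1) by (auto intro: finite_subset)
  qed
  have aQ: "a \<notin> B" if "B \<in> Q" for B
    using nc_partitionsD(5)[OF Q that] by auto
  have "inj_on g R"
  proof (rule inj_on_inverseI)
    show "g X - {a} = X" if "X \<in> R" for X
      using aR(1)[OF that] by (auto simp: g_def)
  qed
  moreover have "Q \<inter> g ` R = {}"
  proof -
    have "g X \<notin> Q" if X: "X \<in> R" for X
    proof -
      obtain y where "y \<in> X" "y \<in> {b..<c}" using nc_partitionsD(5,6)[OF R X] by blast
      then have "y \<in> g X" "y \<notin> {Suc a..<b}" by (auto simp: g_def)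
      then show ?thesis using nc_partitionsD(5)[OF Q] by blast
    qed
    then show ?thesis by blast
  qed
  moreover have "nc_join a b Q R = Q \<union> g ` R" by (simp add: nc_join_def g_def)
  ultimately have "(\<Prod>B\<in>nc_join a b Q R. u (card B + (if a \<in> B then s else 0))) =
    (\<Prod>B\<in>Q. u (card B + (if a \<in> B then s else 0))) * (\<Prod>X\<in>R. u (card (g X) + (if a \<in> g X then s else 0)))"
    using fin by (simp add: prod.union_disjoint prod.reindex)
  also have "(\<Prod>B\<in>Q. u (card B + (if a \<in> B then s else 0))) = (\<Prod>B\<in>Q. u (card B))"
    using aQ by (intro prod.cong) auto
  also have "(\<Prod>X\<in>R. u (card (g X) + (if a \<in> g X then s else 0))) =
      (\<Prod>B\<in>R. u (card B + (if b \<in> B then Suc s else 0)))"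
    using aR by (intro prod.cong) (auto simp: g_def)
  finally show ?thesis .
qed

text \<open>
  Either \<open>a\<close> is a block by itself, of recorded size \<open>Suc s\<close>, or the block continues after \<open>j\<close> skipped
  points; in the latter case the block of the new first point has lost one more element.
\<close>

lemma nc_sum_Suc:
  "nc_sum u s a (Suc n) = u (Suc s) * nc_sum u 0 (Suc a) n +
     (\<Sum>j<n. nc_sum u 0 (Suc a) j * nc_sum u (Suc s) (Suc a + j) (n - j))"
proof -
  let ?c = "Suc a + n"
  let ?N = "nc_partitions {a..<?c}"
  let ?W = "\<lambda>P. \<Prod>B\<in>P. u (card B + (if a \<in> B then s else 0))"
  let ?I = "SIGMA j:{..<n}. nc_partitions {Suc a..<Suc a + j} \<times> nc_partitions {Suc a + j..<?c}"
  let ?j = "\<lambda>(j, Q, R). nc_join a (Suc a + j) Q R"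
  have "(\<Sum>P | P \<in> ?N \<and> {a} \<in> P. ?W P) = (\<Sum>Q\<in>nc_partitions {Suc a..<?c}. ?W (insert {a} Q))"
  proof -
    have notin: "a \<notin> B" if "Q \<in> nc_partitions {Suc a..<?c}" "B \<in> Q" for Q B
      using nc_partitionsD(5)[OF that] by auto
    then have "inj_on (insert {a}) (nc_partitions {Suc a..<?c})"
      by (intro inj_onI) (metis insert_ident insertI1)
    then show ?thesis
      using nc_partitions_singleton[of a ?c] by (simp add: sum.reindex)
  qed
  also have "\<dots> = u (Suc s) * nc_sum u 0 (Suc a) n"
    unfolding nc_sum_def sum_distrib_left
  proof (intro sum.cong refl)
    fix Q assume Q: "Q \<in> nc_partitions {Suc a..<?c}"
    have notin: "a \<notin> B" if "B \<in> Q" for B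
      using nc_partitionsD(5)[OF Q that] by auto
    then have "{a} \<notin> Q" by blast
    moreover have "finite Q" using nc_partition_finite[OF Q] by simp
    moreover have "(\<Prod>B\<in>Q. u (card B + (if a \<in> B then s else 0))) = (\<Prod>B\<in>Q. u (card B))"
      using notin by (intro prod.cong) auto
    ultimately show "?W (insert {a} Q) = u (Suc s) * (\<Prod>B\<in>Q. u (card B + (if Suc a \<in> B then 0 else 0)))"
      by (subst prod.insert) auto
  qed
  finally have singleton: "(\<Sum>P | P \<in> ?N \<and> {a} \<in> P. ?W P) = u (Suc s) * nc_sum u 0 (Suc a) n" .
  have "bij_betw ?j ?I {P. P \<in> ?N \<and> {a} \<notin> P}"
  proof (rule bij_betwI')
    fix y z assume yz: "y \<in> ?I" "z \<in> ?I"
    obtain j Q R k Q' R' where [simp]: "y = (j, Q, R)" "z = (k, Q', R')" by (metis prod_cases3)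
    have *: "j < n" "Q \<in> nc_partitions {Suc a..<Suc a + j}" "R \<in> nc_partitions {Suc a + j..<?c}"
      "k < n" "Q' \<in> nc_partitions {Suc a..<Suc a + k}" "R' \<in> nc_partitions {Suc a + k..<?c}"
      using yz by simp_all
    show "?j y = ?j z \<longleftrightarrow> y = z"
    proof
      assume eq: "?j y = ?j z"
      have aj: "a < Suc a + j" "Suc a + j < ?c" and ak: "a < Suc a + k" "Suc a + k < ?c"
        using *(1,4) by simp_all
      have eq': "nc_join a (Suc a + j) Q R = nc_join a (Suc a + k) Q' R'"
        using eq by simp
      have "Suc a + j = Min {y. y \<noteq> a \<and> (\<exists>B\<in>nc_join a (Suc a + j) Q R. a \<in> B \<and> y \<in> B)}"
        by (rule nc_join_next[OF aj *(2,3), symmetric])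
      also have "\<dots> = Suc a + k"
        unfolding eq' by (rule nc_join_next[OF ak *(5,6)])
      finally have jk: "k = j" by simp
      have "Q = {B \<in> nc_join a (Suc a + j) Q R. B \<subseteq> {Suc a..<Suc a + k}}"
        unfolding jk by (rule nc_join_left_part[OF aj(1) *(2,3), symmetric])
      also have "\<dots> = Q'"
        unfolding eq' by (rule nc_join_left_part[OF ak(1) *(5,6)])
      finally have Q: "Q' = Q" by (rule sym)
      have "R = (\<lambda>B. B - {a}) ` (nc_join a (Suc a + j) Q R - Q')"
        unfolding Q by (rule nc_join_right_part[OF aj(1) *(2,3), symmetric])
      also have "\<dots> = R'"
        unfolding eq' by (rule nc_join_right_part[OF ak(1) *(5,6)])
      finally have "R = R'" .
      with jk Q show "y = z" by simp
    qed simp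
  next
    fix y assume y: "y \<in> ?I"
    obtain j Q R where [simp]: "y = (j, Q, R)" by (metis prod_cases3)
    have *: "j < n" "Q \<in> nc_partitions {Suc a..<Suc a + j}" "R \<in> nc_partitions {Suc a + j..<?c}"
      using y by simp_all
    have "{a} \<notin> nc_join a (Suc a + j) Q R"
    proof
      assume "{a} \<in> nc_join a (Suc a + j) Q R"
      moreover have "{a} \<notin> Q" "{a} \<notin> R"
        using nc_partitionsD(5)[OF *(2), of "{a}"] nc_partitionsD(5)[OF *(3), of "{a}"] by auto
      ultimately show False by (auto simp: nc_join_def split: if_splits)
    qed
    with nc_join_in_nc_partitions[OF _ _ *(2,3)] *(1)
    show "?j y \<in> {P. P \<in> ?N \<and> {a} \<notin> P}" by simp
  next
    fix P assume "P \<in> {P. P \<in> ?N \<and> {a} \<notin> P}"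
    then obtain b Q R where b: "a < b" "b < ?c" "Q \<in> nc_partitions {Suc a..<b}"
      "R \<in> nc_partitions {b..<?c}" "P = nc_join a b Q R"
      using nc_join_surj[of P a ?c] by auto
    define j where "j = b - Suc a"
    have "b = Suc a + j" "j < n" using b by (auto simp: j_def)
    then have "(j, Q, R) \<in> ?I" using b(3,4) by simp
    moreover have "P = ?j (j, Q, R)" using b(5) \<open>b = Suc a + j\<close> by simp
    ultimately show "\<exists>y\<in>?I. P = ?j y" by (rule rev_bexI)
  qed
  then have "(\<Sum>P | P \<in> ?N \<and> {a} \<notin> P. ?W P) = (\<Sum>y\<in>?I. ?W (?j y))"
    by (simp add: sum.reindex_bij_betw)
  also have "\<dots> = (\<Sum>(j, Q, R)\<in>?I. (\<Prod>B\<in>Q. u (card B)) *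
      (\<Prod>B\<in>R. u (card B + (if Suc a + j \<in> B then Suc s else 0))))"
  proof (intro sum.cong refl)
    fix y assume y: "y \<in> ?I"
    obtain j Q R where [simp]: "y = (j, Q, R)" by (metis prod_cases3)
    have "Q \<in> nc_partitions {Suc a..<Suc a + j}" "R \<in> nc_partitions {Suc a + j..<?c}"
      using y by simp_all
    from prod_nc_join[OF _ this] show "?W (?j y) = (case y of (j, Q, R) \<Rightarrow> (\<Prod>B\<in>Q. u (card B)) *
      (\<Prod>B\<in>R. u (card B + (if Suc a + j \<in> B then Suc s else 0))))"
      by simp
  qed
  also have "\<dots> = (\<Sum>j<n. nc_sum u 0 (Suc a) j * nc_sum u (Suc s) (Suc a + j) (n - j))"
    by (simp add: nc_sum_def sum_product sum.Sigma sum.cartesian_product split_def)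
  finally have "(\<Sum>P | P \<in> ?N \<and> {a} \<notin> P. ?W P) =
    (\<Sum>j<n. nc_sum u 0 (Suc a) j * nc_sum u (Suc s) (Suc a + j) (n - j))" .
  moreover have "nc_sum u s a (Suc n) = (\<Sum>P | P \<in> ?N \<and> {a} \<in> P. ?W P) + (\<Sum>P | P \<in> ?N \<and> {a} \<notin> P. ?W P)"
  proof -
    have "nc_sum u s a (Suc n) = sum ?W ({P. P \<in> ?N \<and> {a} \<in> P} \<union> {P. P \<in> ?N \<and> {a} \<notin> P})"
      unfolding nc_sum_def by (intro sum.cong) auto
    also have "\<dots> = (\<Sum>P | P \<in> ?N \<and> {a} \<in> P. ?W P) + (\<Sum>P | P \<in> ?N \<and> {a} \<notin> P. ?W P)"
      by (rule sum.union_disjoint) auto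
    finally show ?thesis .
  qed
  ultimately show ?thesis using singleton by simp
qed

text \<open>
  The value at \<open>s = 0\<close> is the moment. For larger \<open>s\<close> the block of the first point is counted with
  \<open>s\<close> additional elements. The value at \<open>n = 0\<close> is \<open>1\<close> for every \<open>s\<close>, since there is no first
  point.
\<close>

fun free_moment :: "(nat \<Rightarrow> 'a::field) \<Rightarrow> nat \<Rightarrow> nat \<Rightarrow> 'a" where
  "free_moment u s 0 = 1"
| "free_moment u s (Suc n) = u (Suc s) * free_moment u 0 n +
     (\<Sum>j<n. free_moment u 0 j * free_moment u (Suc s) (n - j))"

lemma nc_sum_eq_free_moment: "nc_sum u s a n = free_moment u s n"
proof (induction n arbitrary: s a rule: less_induct)
  case (less n)
  show ?case
  proof (cases n)
    case 0
    have "nc_partitions {} = {{}}"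
      by (auto simp: nc_partitions_def partition_on_def noncrossing_def)
    with 0 show ?thesis by (simp add: nc_sum_def)
  next
    case (Suc m)
    have "nc_sum u 0 (Suc a) m = free_moment u 0 m"
      by (rule less.IH) (simp add: Suc)
    moreover have "(\<Sum>j<m. nc_sum u 0 (Suc a) j * nc_sum u (Suc s) (Suc a + j) (m - j)) =
        (\<Sum>j<m. free_moment u 0 j * free_moment u (Suc s) (m - j))"
      by (intro sum.cong refl arg_cong2[where f = "(*)"] less.IH) (auto simp: Suc)
    ultimately show ?thesis unfolding Suc nc_sum_Suc by simp
  qed
qed

lemma sum_NC: "(\<Sum>\<eta>\<in>NC n. part_prod u \<eta>) = free_moment u 0 n"
proof -
  have "NC n = nc_partitions {1..<1 + n}"
    by (simp add: NC_def set_partitions_def nc_partitions_def atLeastLessThanSuc_atLeastAtMost)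
  then have "(\<Sum>\<eta>\<in>NC n. part_prod u \<eta>) = nc_sum u 0 1 n"
    by (simp add: nc_sum_def part_prod_def)
  then show ?thesis by (simp add: nc_sum_eq_free_moment)
qed


section \<open>Weights that are multiplicative under insertion\<close>

lemma subtree_at_Leaf [simp]: "subtree_at p Leaf = Leaf"
  by (cases p) auto

lemma vertices_nonempty: "v \<in> vertices T \<Longrightarrow> T \<noteq> Leaf"
  by (auto simp: vertices_def)

lemma subtree_at_replace_at: "v \<in> vertices T \<Longrightarrow> subtree_at v (replace_at v T s) = s"
  unfolding vertices_def by (induction v T s rule: replace_at.induct) auto

lemma replace_at_replace_at: "v \<in> vertices T \<Longrightarrow> replace_at v (replace_at v T s) s' = replace_at v T s'"
  unfolding vertices_def by (induction v T s rule: replace_at.induct) auto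

lemma replace_at_subtree_at: "v \<in> vertices T \<Longrightarrow> replace_at v T (subtree_at v T) = T"
  unfolding vertices_def by (induction v T rule: subtree_at.induct) auto

lemma subtree_at_insertion:
  "v \<in> vertices T1 \<Longrightarrow> subtree_at v (insertion b v T1 T2) = Node (subtree_at v T1) b T2"
  by (simp add: insertion_def subtree_at_replace_at)

lemma vertex_of_insertion: "v \<in> vertices T1 \<Longrightarrow> v \<in> vertices (insertion b v T1 T2)"
  using subtree_at_insertion[of v T1 b T2] by (simp add: vertices_def)

lemma decomposition_insertion:
  "v \<in> vertices T1 \<Longrightarrow> decomposition v (insertion b v T1 T2) = (T1, T2)"
  by (simp add: decomposition_def subtree_at_insertion)
     (simp add: insertion_def replace_at_replace_at replace_at_subtree_at)

text \<open>
  This is the only trace that the troupe axioms and the insertion-additive statistics leave in the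
  counting argument. It is stated with a second function \<open>\<alpha>\<close> because the recursion at the root leads
  from a weight \<open>w\<close> to weights like \<open>\<lambda>T. w (Node T x Leaf)\<close>: inserting into the part below the root
  still splits off a factor \<open>w T2\<close>, but the remaining factor sees the tree together with its root.
\<close>

definition right_multiplicative :: "'c \<Rightarrow> ('c tree \<Rightarrow> 'a::comm_ring_1) \<Rightarrow> ('c tree \<Rightarrow> 'a) \<Rightarrow> bool" where
  "right_multiplicative b w \<alpha> \<longleftrightarrow>
     (\<forall>T1 T2. \<forall>v\<in>vertices T1. T2 \<noteq> Leaf \<longrightarrow> \<alpha> (insertion b v T1 T2) = \<alpha> T1 * w T2) \<and>
     (\<forall>T. \<forall>v\<in>vertices T. two_children T v \<longrightarrow> color_at T v \<noteq> b \<longrightarrow> \<alpha> T = 0)"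

lemma right_multiplicative_left:
  assumes "right_multiplicative b w \<alpha>"
  shows "right_multiplicative b w (\<lambda>T. \<alpha> (Node T x Leaf))"
  unfolding right_multiplicative_def
proof (intro conjI allI ballI impI)
  fix T1 T2 :: "'a tree" and v assume "v \<in> vertices T1" "T2 \<noteq> Leaf"
  then show "\<alpha> (Node (insertion b v T1 T2) x Leaf) = \<alpha> (Node T1 x Leaf) * w T2"
    using assms[unfolded right_multiplicative_def, THEN conjunct1, rule_format,
        of "Lft # v" "Node T1 x Leaf" T2]
    by (simp add: vertices_def insertion_def)
next
  fix T v assume "v \<in> vertices T" "two_children T v" "color_at T v \<noteq> b"
  then show "\<alpha> (Node T x Leaf) = 0"
    using assms[unfolded right_multiplicative_def, THEN conjunct2, rule_format,
        of "Lft # v" "Node T x Leaf"]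
    by (simp add: vertices_def two_children_def color_at_def)
qed

lemma right_multiplicative_right:
  assumes "right_multiplicative b w \<alpha>"
  shows "right_multiplicative b w (\<lambda>T. \<alpha> (Node Leaf x T))"
  unfolding right_multiplicative_def
proof (intro conjI allI ballI impI)
  fix T1 T2 :: "'a tree" and v assume "v \<in> vertices T1" "T2 \<noteq> Leaf"
  then show "\<alpha> (Node Leaf x (insertion b v T1 T2)) = \<alpha> (Node Leaf x T1) * w T2"
    using assms[unfolded right_multiplicative_def, THEN conjunct1, rule_format,
        of "Rgt # v" "Node Leaf x T1" T2]
    by (simp add: vertices_def insertion_def)
next
  fix T v assume "v \<in> vertices T" "two_children T v" "color_at T v \<noteq> b"
  then show "\<alpha> (Node Leaf x T) = 0"
    using assms[unfolded right_multiplicative_def, THEN conjunct2, rule_format,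
        of "Rgt # v" "Node Leaf x T"]
    by (simp add: vertices_def two_children_def color_at_def)
qed

text \<open>
  A tree whose root is black and has two children arises by inserting the right subtree above the root
  of the left subtree.
\<close>

lemma right_multiplicative_two_children:
  assumes "right_multiplicative b w \<alpha>" "L \<noteq> Leaf" "R \<noteq> Leaf"
  shows "\<alpha> (Node L x R) = (if x = b then \<alpha> L * w R else 0)"
proof (cases "x = b")
  case True
  then show ?thesis
    using assms(1)[unfolded right_multiplicative_def, THEN conjunct1, rule_format, of "[]" L R] assms(2,3)
    by (simp add: vertices_def insertion_def)
next
  case False
  then show ?thesis
    using assms(1)[unfolded right_multiplicative_def, THEN conjunct2, rule_format, of "[]" "Node L x R"] assms(2,3)
    by (simp add: vertices_def two_children_def color_at_def)
qed

lemma bij_betw_Node_trees_of_size: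
  "bij_betw (\<lambda>(k, L, R, x). Node L x R)
     (SIGMA k:{..n}. SIGMA L:{T. size T = k}. {T. size T = n - k} \<times> UNIV)
     {T. size T = Suc n}" (is "bij_betw ?j ?I ?S")
proof (rule bij_betwI[where g = "\<lambda>T. (size (left T), left T, right T, value T)"])
  show "?j \<in> ?I \<rightarrow> ?S" by auto
  show "(\<lambda>T. (size (left T), left T, right T, value T)) \<in> ?S \<rightarrow> ?I"
  proof
    fix T :: "'a tree" assume "T \<in> ?S"
    then show "(size (left T), left T, right T, value T) \<in> ?I"
      by (cases T) auto
  qed
  show "(size (left (?j y)), left (?j y), right (?j y), value (?j y)) = y" if "y \<in> ?I" for y
    using that by auto
  show "?j (size (left T), left T, right T, value T) = T" if "T \<in> ?S" for T
    using that by (cases T) auto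
qed

lemma finite_trees_of_size: "finite {T :: 'c::finite tree. size T = n}"
proof (induction n rule: less_induct)
  case (less n)
  show ?case
  proof (cases n)
    case (Suc m)
    have "finite (SIGMA k:{..m}. SIGMA L:{T :: 'c tree. size T = k}.
        {T :: 'c tree. size T = m - k} \<times> (UNIV :: 'c set))"
      using less Suc by (intro finite_SigmaI) auto
    then show ?thesis
      using bij_betw_finite[OF bij_betw_Node_trees_of_size[where ?'a = 'c and n = m]] Suc by simp
  qed simp
qed

lemma sum_trees_Suc:
  fixes g :: "'c::finite tree \<Rightarrow> 'a::comm_monoid_add"
  shows "(\<Sum>T | size T = Suc n. g T) =
    (\<Sum>k\<le>n. \<Sum>L | size L = k. \<Sum>R | size R = n - k. \<Sum>x\<in>UNIV. g (Node L x R))"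
  by (subst sum.reindex_bij_betw[OF bij_betw_Node_trees_of_size, symmetric])
     (simp add: sum.Sigma finite_trees_of_size split_def)

text \<open>
  The empty tree is left out because insertion only concerns nonempty trees. Its weight is handled
  separately throughout.
\<close>

definition tree_sum :: "('c tree \<Rightarrow> 'a::comm_ring_1) \<Rightarrow> ('c tree \<Rightarrow> 'a) \<Rightarrow> nat \<Rightarrow> 'a" where
  "tree_sum \<theta> \<alpha> n = (if n = 0 then 0 else \<Sum>T | size T = n. \<theta> T * \<alpha> T)"

lemma tree_sum_0 [simp]: "tree_sum \<theta> \<alpha> 0 = 0"
  by (simp add: tree_sum_def)

text \<open>
  Decomposition at the root: a root without children, with one child (which modifies \<open>\<alpha>\<close>), or with
  two children (where the weight factorizes). In the applications, \<open>\<theta>\<close> is either constantly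
  \<open>1\<close> or the number of decreasing labelings, and \<open>\<beta>\<close> is accordingly \<open>1\<close> or the number of ways to
  distribute the labels to the two subtrees. In the convolution the terms \<open>k = 0\<close> and \<open>k = n\<close> vanish, so they do not overlap with the one-child
  case.
\<close>

lemma tree_sum_Suc:
  fixes \<alpha> w :: "'c::finite tree \<Rightarrow> 'a::comm_ring_1"
  assumes mult: "right_multiplicative b w \<alpha>"
    and \<theta>_Leaf: "\<theta> Leaf = 1"
    and \<theta>_Node: "\<And>L x R. \<theta> (Node L x R) = \<beta> (size L) (size R) * \<theta> L * \<theta> R"
    and \<beta>: "\<And>n. \<beta> 0 n = 1" "\<And>n. \<beta> n 0 = 1"
  shows "tree_sum \<theta> \<alpha> (Suc n) =
      (if n = 0 then \<Sum>x\<in>UNIV. \<alpha> (Node Leaf x Leaf) else 0) +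
      (\<Sum>x\<in>UNIV. tree_sum \<theta> (\<lambda>T. \<alpha> (Node T x Leaf)) n + tree_sum \<theta> (\<lambda>T. \<alpha> (Node Leaf x T)) n) +
      (\<Sum>k\<le>n. \<beta> k (n - k) * tree_sum \<theta> \<alpha> k * tree_sum \<theta> w (n - k))"
proof (cases "n = 0")
  case True
  have "{T :: 'c tree. size T = 0} = {Leaf}" by auto
  with True show ?thesis
    by (simp add: tree_sum_def sum_trees_Suc \<theta>_Leaf \<theta>_Node \<beta>)
next
  case False
  have 0: "{T :: 'c tree. size T = 0} = {Leaf}" by auto
  let ?A = "\<Sum>x\<in>UNIV. tree_sum \<theta> (\<lambda>T. \<alpha> (Node T x Leaf)) n"
  let ?B = "\<Sum>x\<in>UNIV. tree_sum \<theta> (\<lambda>T. \<alpha> (Node Leaf x T)) n"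
  let ?C = "\<lambda>k. \<beta> k (n - k) * tree_sum \<theta> \<alpha> k * tree_sum \<theta> w (n - k)"
  let ?F = "\<lambda>k. \<Sum>L | size L = k. \<Sum>R | size R = n - k. \<Sum>x\<in>UNIV.
              \<theta> (Node L x R) * \<alpha> (Node L x R)"
  have "?F k = (if k = 0 then ?B else 0) + (if k = n then ?A else 0) + ?C k" if k: "k \<le> n" for k
  proof -
    consider "k = 0" | "k = n" | "0 < k" "k < n" using k by linarith
    then show ?thesis
    proof cases
      case 1
      have "?F 0 = ?B" unfolding 0
        using False by (simp add: \<theta>_Leaf \<theta>_Node \<beta> tree_sum_def) (rule sum.swap)
      with 1 False show ?thesis by simp
    next
      case 2
      have "?F n = ?A"
        using False by (simp add: 0 \<theta>_Leaf \<theta>_Node \<beta> tree_sum_def) (rule sum.swap)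
      with 2 False show ?thesis by simp
    next
      case 3
      have "?F k = (\<Sum>L | size L = k. \<Sum>R | size R = n - k. \<beta> k (n - k) * (\<theta> L * \<alpha> L) * (\<theta> R * w R))"
      proof (intro sum.cong refl)
        fix L R :: "'c tree" assume LR: "L \<in> {L. size L = k}" "R \<in> {R. size R = n - k}"
        with 3 have ne: "L \<noteq> Leaf" "R \<noteq> Leaf" by auto
        have "(\<Sum>x\<in>UNIV. \<theta> (Node L x R) * \<alpha> (Node L x R)) =
              (\<Sum>x\<in>UNIV. if x = b then \<beta> k (n - k) * \<theta> L * \<theta> R * (\<alpha> L * w R) else 0)"
          using LR by (intro sum.cong refl)
            (simp add: \<theta>_Node right_multiplicative_two_children[OF mult ne])
        then show "(\<Sum>x\<in>UNIV. \<theta> (Node L x R) * \<alpha> (Node L x R)) =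
              \<beta> k (n - k) * (\<theta> L * \<alpha> L) * (\<theta> R * w R)"
          by (simp add: mult_ac)
      qed
      also have "\<dots> = ?C k"
      proof -
        have "?C k = \<beta> k (n - k) * ((\<Sum>L | size L = k. \<theta> L * \<alpha> L) * (\<Sum>R | size R = n - k. \<theta> R * w R))"
          using 3 by (simp add: tree_sum_def mult.assoc)
        also have "(\<Sum>L | size L = k. \<theta> L * \<alpha> L) * (\<Sum>R | size R = n - k. \<theta> R * w R) =
            (\<Sum>L | size L = k. \<Sum>R | size R = n - k. \<theta> L * \<alpha> L * (\<theta> R * w R))"
          by (rule sum_product)
        finally show ?thesis
          by (simp only: sum_distrib_left mult.assoc)
      qed
      finally show ?thesis using 3 by simp
    qed
  qed
  then have "tree_sum \<theta> \<alpha> (Suc n) = (\<Sum>k\<le>n. (if k = 0 then ?B else 0) + (if k = n then ?A else 0) + ?C k)"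
    by (simp add: tree_sum_def[of _ _ "Suc n"] sum_trees_Suc)
  with False show ?thesis by (simp add: sum.distrib add_ac)
qed


section \<open>Counting decreasing labelings\<close>

fun num_decreasing_labelings :: "'c tree \<Rightarrow> nat" where
  "num_decreasing_labelings Leaf = 1"
| "num_decreasing_labelings (Node L x R) =
     (size L + size R choose size L) * num_decreasing_labelings L * num_decreasing_labelings R"

lemma num_decreasing_labelings_pos: "num_decreasing_labelings T > 0"
  by (induction T) auto

lemma labels_simps [simp]:
  "labels Leaf = {}" "labels (Node L p R) = insert (snd p) (labels L \<union> labels R)"
  by (auto simp: labels_def)

lemma skel_simps [simp]: "skel Leaf = Leaf" "skel (Node L p R) = Node (skel L) (fst p) (skel R)"
  by (simp_all add: skel_def)

lemma size_skel [simp]: "size (skel t) = size t"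
  by (simp add: skel_def)

lemma skel_eq_Leaf [simp]: "skel t = Leaf \<longleftrightarrow> t = Leaf"
  by (cases t) auto

lemma labels_less: "children_less t \<Longrightarrow> root_less t k \<Longrightarrow> y \<in> labels t \<Longrightarrow> y < k"
proof (induction t arbitrary: k)
  case (Node L p R)
  then have "y = snd p \<or> y < snd p" by auto
  with Node.prems show ?case by auto
qed simp

lemma root_less_iff: "children_less t \<Longrightarrow> root_less t k \<longleftrightarrow> (\<forall>y\<in>labels t. y < k)"
  using labels_less[of t k] by (cases t) (auto simp del: children_less.simps)

lemma decreasing_tree_Leaf [simp]: "decreasing_tree Leaf"
  by (simp add: decreasing_tree_def)

lemma decreasing_tree_Node:
  "decreasing_tree (Node L p R) \<longleftrightarrow> decreasing_tree L \<and> decreasing_tree R \<and>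
     labels L \<inter> labels R = {} \<and> 0 < snd p \<and> (\<forall>y\<in>labels L \<union> labels R. y < snd p)"
  unfolding decreasing_tree_def
  by (auto simp: root_less_iff simp flip: labels_def dest: less_imp_neq)

lemma card_labels: "decreasing_tree t \<Longrightarrow> card (labels t) = size t"
  using distinct_card[of "map snd (inorder t)"] by (simp add: decreasing_tree_def labels_def)

text \<open>
  The root must carry the largest label. The remaining labels are shared between the two subtrees in
  an arbitrary way, subject only to the sizes.
\<close>

lemma card_decreasing_labelings:
  assumes "finite S" "0 \<notin> S" "card S = size T"
  shows "card {t. decreasing_tree t \<and> labels t = S \<and> skel t = T} = num_decreasing_labelings T"
  using assms
proof (induction T arbitrary: S)
  case Leaf
  then have "{t :: ('a \<times> nat) tree. decreasing_tree t \<and> labels t = S \<and> skel t = Leaf} = {Leaf}"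
    by auto
  then show ?case by simp
next
  case (Node L x R)
  define M where "M = Max S"
  define S' where "S' = S - {M}"
  have S: "S \<noteq> {}" using Node.prems by auto
  have M: "M \<in> S" "M > 0"
    using Max_in[OF Node.prems(1) S] Node.prems(2) by (auto simp: M_def intro: gr0I)
  have less_M: "y < M" if "y \<in> S'" for y
    using that Max_ge[OF Node.prems(1), of y] by (simp add: S'_def M_def)
  have S': "finite S'" "0 \<notin> S'" "card S' = size L + size R"
    using Node.prems M by (auto simp: S'_def)
  let ?D = "\<lambda>S T. {t :: ('a \<times> nat) tree. decreasing_tree t \<and> labels t = S \<and> skel t = T}"
  let ?I = "SIGMA A:{A. A \<subseteq> S' \<and> card A = size L}. ?D A L \<times> ?D (S' - A) R"
  let ?j = "\<lambda>(A :: nat set, l, r). Node l (x, M) r"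
  have IH: "card (?D A L) = num_decreasing_labelings L"
      "card (?D (S' - A) R) = num_decreasing_labelings R"
    if A: "A \<subseteq> S'" "card A = size L" for A
  proof -
    have "finite A" using A S' finite_subset by blast
    then have "card (S' - A) = size R" using A S' by (simp add: card_Diff_subset)
    then show "card (?D A L) = num_decreasing_labelings L"
      "card (?D (S' - A) R) = num_decreasing_labelings R"
      using A S' \<open>finite A\<close> by (auto intro!: Node.IH)
  qed
  have root: "snd p = M" "S' = labels l \<union> labels r"
    if "decreasing_tree (Node l p r)" "labels (Node l p r) = S" for l r and p :: "'a \<times> nat"
  proof -
    have less: "\<forall>y\<in>labels l \<union> labels r. y < snd p"
      using that(1) by (simp add: decreasing_tree_Node)
    have "Max S = snd p"
      using less that(2) Node.prems(1) by (intro Max_eqI) (auto intro: less_imp_le)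
    then show "snd p = M" by (simp add: M_def)
    then show "S' = labels l \<union> labels r"
      using less that(2) unfolding S'_def by auto
  qed
  have "bij_betw ?j ?I (?D S (Node L x R))"
  proof (rule bij_betwI[where g = "\<lambda>t. (labels (left t), left t, right t)"])
    show "?j \<in> ?I \<rightarrow> ?D S (Node L x R)"
    proof
      fix y assume "y \<in> ?I"
      then obtain A l r where y: "y = (A, l, r)" and A: "A \<subseteq> S'"
        and l: "decreasing_tree l" "labels l = A" "skel l = L"
        and r: "decreasing_tree r" "labels r = S' - A" "skel r = R"
        by auto
      have "\<forall>z\<in>labels l \<union> labels r. z < M"
        using l r A less_M by blast
      then have "decreasing_tree (Node l (x, M) r)"
        using l r M unfolding decreasing_tree_Node by auto
      moreover have "labels (Node l (x, M) r) = S"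
        using l r A M by (auto simp: S'_def)
      ultimately show "?j y \<in> ?D S (Node L x R)"
        using l r by (simp add: y)
    qed
    show "(\<lambda>t. (labels (left t), left t, right t)) \<in> ?D S (Node L x R) \<rightarrow> ?I"
    proof
      fix t assume t: "t \<in> ?D S (Node L x R)"
      then obtain l p r where lpr: "t = Node l p r" by (cases t) auto
      with t have *: "decreasing_tree (Node l p r)" "labels (Node l p r) = S" by simp_all
      then have dec: "decreasing_tree l" "decreasing_tree r" "labels l \<inter> labels r = {}"
        by (simp_all add: decreasing_tree_Node)
      then have "labels r = S' - labels l" "labels l \<subseteq> S'"
        unfolding root(2)[OF *] by blast+
      with t lpr dec card_labels[of l] show "(labels (left t), left t, right t) \<in> ?I"
        by auto
    qed
    show "(labels (left (?j y)), left (?j y), right (?j y)) = y" if "y \<in> ?I" for y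
      using that by auto
    show "?j (labels (left t), left t, right t) = t" if t: "t \<in> ?D S (Node L x R)" for t
    proof -
      obtain l p r where lpr: "t = Node l p r" using t by (cases t) auto
      with t have "snd p = M" by (intro root[of l p r]) simp_all
      moreover have "fst p = x" using t lpr by simp
      ultimately show ?thesis using lpr by (cases p) simp
    qed
  qed
  then have "card (?D S (Node L x R)) = card ?I" by (simp add: bij_betw_same_card)
  also have "\<dots> = (\<Sum>A | A \<subseteq> S' \<and> card A = size L. card (?D A L \<times> ?D (S' - A) R))"
  proof (rule card_SigmaI)
    show "\<forall>A\<in>{A. A \<subseteq> S' \<and> card A = size L}. finite (?D A L \<times> ?D (S' - A) R)"
    proof
      fix A assume "A \<in> {A. A \<subseteq> S' \<and> card A = size L}"
      then have "card (?D A L) = num_decreasing_labelings L" "card (?D (S' - A) R) = num_decreasing_labelings R"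
        using IH by simp_all
      then have "card (?D A L) > 0" "card (?D (S' - A) R) > 0"
        using num_decreasing_labelings_pos by metis+
      then show "finite (?D A L \<times> ?D (S' - A) R)"
        by (intro finite_cartesian_product card_ge_0_finite)
    qed
  qed (use S' in auto)
  also have "\<dots> = (\<Sum>A | A \<subseteq> S' \<and> card A = size L.
        num_decreasing_labelings L * num_decreasing_labelings R)"
    using IH by (intro sum.cong) (auto simp: card_cartesian_product)
  also have "\<dots> = num_decreasing_labelings (Node L x R)"
    using n_subsets[OF S'(1)] S'(3) by simp
  finally show ?case .
qed

lemma sum_decreasing_trees_of_size:
  fixes g :: "'c::finite tree \<Rightarrow> 'a::comm_ring_1"
  shows "(\<Sum>t\<in>decreasing_trees_of_size TT n. g (skel t)) =
    (\<Sum>T | size T = n. of_nat (num_decreasing_labelings T) * (if T \<in> TT then g T else 0))"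
proof -
  let ?D = "\<lambda>T. {t. decreasing_tree t \<and> labels t = {1..n} \<and> skel t = T}"
  have card: "card (?D T) = num_decreasing_labelings T" if "size T = n" for T :: "'c tree"
    using card_decreasing_labelings[of "{1..n}" T] that by simp
  then have fin: "finite (?D T)" if "size T = n" for T :: "'c tree"
    using that num_decreasing_labelings_pos[of T] by (intro card_ge_0_finite) simp
  have "decreasing_trees_of_size TT n = (\<Union>T\<in>trees_of_size TT n. ?D T)"
    by (auto simp: decreasing_trees_of_size_def trees_of_size_def)
  moreover have "(\<Sum>t\<in>(\<Union>T\<in>trees_of_size TT n. ?D T). g (skel t)) = (\<Sum>T\<in>trees_of_size TT n. \<Sum>t\<in>?D T. g (skel t))"
  proof (rule sum.UNION_disjoint)
    show "finite (trees_of_size TT n)"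
      using finite_trees_of_size[of n] by (rule rev_finite_subset) (auto simp: trees_of_size_def)
    show "\<forall>T\<in>trees_of_size TT n. finite (?D T)"
      using fin by (simp add: trees_of_size_def)
  qed auto
  ultimately have "(\<Sum>t\<in>decreasing_trees_of_size TT n. g (skel t)) = (\<Sum>T\<in>trees_of_size TT n. \<Sum>t\<in>?D T. g (skel t))"
    by simp
  also have "\<dots> = (\<Sum>T\<in>trees_of_size TT n. of_nat (num_decreasing_labelings T) * g T)"
    using card by (intro sum.cong refl) (simp add: trees_of_size_def)
  also have "\<dots> = (\<Sum>T | size T = n. of_nat (num_decreasing_labelings T) * (if T \<in> TT then g T else 0))"
    using finite_trees_of_size[of n] by (intro sum.mono_neutral_cong_left) (auto simp: trees_of_size_def)
  finally show ?thesis .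
qed


section \<open>Binomial convolution\<close>

text \<open>
  This is the product of exponential generating functions, read off from the coefficients; in this
  form there is no division by factorials, and the product makes sense over every commutative ring.
  The shift \<open>\<lambda>n. a (Suc n)\<close> plays the role of the derivative, and the Leibniz rule below replaces
  most manipulations of sums.
\<close>

definition binomial_convolution ::
    "(nat \<Rightarrow> 'a::comm_ring_1) \<Rightarrow> (nat \<Rightarrow> 'a) \<Rightarrow> nat \<Rightarrow> 'a" (infixl "\<star>" 70) where
  "(a \<star> b) n = (\<Sum>k\<le>n. of_nat (n choose k) * a k * b (n - k))"

lemma binomial_convolution_0 [simp]: "(a \<star> b) 0 = a 0 * b 0"
  by (simp add: binomial_convolution_def)

lemma binomial_convolution_Suc:
  "(a \<star> b) (Suc n) = ((\<lambda>n. a (Suc n)) \<star> b) n + (a \<star> (\<lambda>n. b (Suc n))) n"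
proof -
  have "(a \<star> (\<lambda>n. b (Suc n))) n = (\<Sum>k\<le>n. of_nat (n choose k) * a k * b (Suc n - k))"
    unfolding binomial_convolution_def by (intro sum.cong) (auto simp: Suc_diff_le)
  also have "\<dots> = (\<Sum>k\<le>Suc n. of_nat (n choose k) * a k * b (Suc n - k))"
    by (simp add: binomial_eq_0)
  also have "\<dots> = a 0 * b (Suc n) + (\<Sum>k\<le>n. of_nat (n choose Suc k) * a (Suc k) * b (n - k))"
    by (subst sum.atMost_Suc_shift) simp
  finally show ?thesis
    unfolding binomial_convolution_def[of a b]
    by (subst sum.atMost_Suc_shift) (simp add: binomial_convolution_def sum.distrib algebra_simps)
qed

lemma binomial_convolution_add_left: "((\<lambda>n. a n + b n) \<star> c) n = (a \<star> c) n + (b \<star> c) n"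
  and binomial_convolution_add_right: "(c \<star> (\<lambda>n. a n + b n)) n = (c \<star> a) n + (c \<star> b) n"
  and binomial_convolution_scale_right: "(c \<star> (\<lambda>n. x * a n)) n = x * (c \<star> a) n"
  and binomial_convolution_minus_left: "((\<lambda>n. - a n) \<star> c) n = - (a \<star> c) n"
  and binomial_convolution_minus_right: "(c \<star> (\<lambda>n. - a n)) n = - (c \<star> a) n"
  by (simp_all add: binomial_convolution_def algebra_simps sum.distrib sum_distrib_left sum_negf)

lemma binomial_convolution_sum_left: "((\<lambda>n. \<Sum>i\<in>I. a i n) \<star> c) n = (\<Sum>i\<in>I. (a i \<star> c) n)"
  unfolding binomial_convolution_def
  by (subst sum.swap) (simp add: sum_distrib_left sum_distrib_right)

lemma binomial_convolution_delta_left: "((\<lambda>n. if n = 0 then x else 0) \<star> c) n = x * c n"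
proof -
  have "((\<lambda>n. if n = 0 then x else 0) \<star> c) n = (\<Sum>k\<le>n. if k = 0 then x * c n else 0)"
    unfolding binomial_convolution_def by (intro sum.cong) auto
  then show ?thesis by simp
qed

text \<open>
  By the Leibniz rule, the shifts of both sides are sums of corresponding threefold products.
\<close>

lemma binomial_convolution_assoc: "((a \<star> b) \<star> c) n = (a \<star> (b \<star> c)) n"
proof (induction n arbitrary: a b c)
  case (Suc n)
  show ?case
    unfolding binomial_convolution_Suc[of "a \<star> b"] binomial_convolution_Suc[of a "b \<star> c"]
      binomial_convolution_Suc[of a b] binomial_convolution_Suc[of b c]
      binomial_convolution_add_left binomial_convolution_add_right Suc.IH
    by (simp add: add.assoc)
qed (simp add: mult.assoc)


section \<open>Decreasing trees and classical moments\<close>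

abbreviation labeling_count :: "'c tree \<Rightarrow> 'a::comm_ring_1" where
  "labeling_count T \<equiv> of_nat (num_decreasing_labelings T)"

text \<open>
  In exponential generating functions: if \<open>D \<alpha>\<close> counts decreasing trees with weight \<open>\<alpha>\<close>, then
  \<open>(D \<alpha>)'\<close> is the total \<open>\<alpha>\<close>-weight of the one-vertex trees, plus the series \<open>D\<close> of the weights
  modified by a root with a single child, plus \<open>D \<alpha> * D w\<close>.
\<close>

lemma decreasing_tree_sum_Suc:
  fixes \<alpha> w :: "'c::finite tree \<Rightarrow> 'a::comm_ring_1"
  assumes "right_multiplicative b w \<alpha>"
  shows "tree_sum labeling_count \<alpha> (Suc n) =
      (if n = 0 then \<Sum>x\<in>UNIV. \<alpha> (Node Leaf x Leaf) else 0) +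
      (\<Sum>x\<in>UNIV. tree_sum labeling_count (\<lambda>T. \<alpha> (Node T x Leaf)) n +
                  tree_sum labeling_count (\<lambda>T. \<alpha> (Node Leaf x T)) n) +
      (tree_sum labeling_count \<alpha> \<star> tree_sum labeling_count w) n"
  by (subst tree_sum_Suc[OF assms, where \<beta> = "\<lambda>k l. of_nat (k + l choose k)"])
     (simp_all add: binomial_convolution_def)

text \<open>
  Assume \<open>m' = - (w Leaf + D w) * m\<close> and differentiate \<open>D \<alpha> * m\<close>. The quadratic term \<open>D \<alpha> * D w * m\<close>
  from \<open>(D \<alpha>)'\<close> cancels against the one from \<open>m'\<close>, and what remains is a linear recursion.
\<close>

lemma labeling_convolution_recursion:
  fixes \<alpha> w :: "'c::finite tree \<Rightarrow> 'a::comm_ring_1"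
  assumes mult: "right_multiplicative b w \<alpha>"
    and m: "\<And>n. m (Suc n) = - (w Leaf * m n + (tree_sum labeling_count w \<star> m) n)"
  shows "(tree_sum labeling_count \<alpha> \<star> m) (Suc n) =
      (\<Sum>x\<in>UNIV. \<alpha> (Node Leaf x Leaf)) * m n +
      (\<Sum>x\<in>UNIV. (tree_sum labeling_count (\<lambda>T. \<alpha> (Node T x Leaf)) \<star> m) n +
                  (tree_sum labeling_count (\<lambda>T. \<alpha> (Node Leaf x T)) \<star> m) n) -
      w Leaf * (tree_sum labeling_count \<alpha> \<star> m) n"
  unfolding binomial_convolution_Suc m decreasing_tree_sum_Suc[OF mult]
    binomial_convolution_add_left binomial_convolution_delta_left binomial_convolution_sum_left
    binomial_convolution_minus_right binomial_convolution_add_right binomial_convolution_scale_right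
    binomial_convolution_assoc
  by simp


section \<open>Trees and free moments\<close>

definition tree_fps :: "('c tree \<Rightarrow> 'a::comm_ring_1) \<Rightarrow> 'a fps" where
  "tree_fps \<alpha> = Abs_fps (tree_sum (\<lambda>_. 1) \<alpha>)"

lemma tree_fps_nth_0 [simp]: "tree_fps \<alpha> $ 0 = 0"
  by (simp add: tree_fps_def)

lemma tree_fps_eq:
  fixes \<alpha> w :: "'c::finite tree \<Rightarrow> 'a::comm_ring_1"
  assumes "right_multiplicative b w \<alpha>"
  shows "tree_fps \<alpha> = fps_X * (fps_const (\<Sum>x\<in>UNIV. \<alpha> (Node Leaf x Leaf)) +
      (\<Sum>x\<in>UNIV. tree_fps (\<lambda>T. \<alpha> (Node T x Leaf)) + tree_fps (\<lambda>T. \<alpha> (Node Leaf x T))) +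
      tree_fps \<alpha> * tree_fps w)"
proof (rule fps_ext)
  fix n
  show "tree_fps \<alpha> $ n = (fps_X * (fps_const (\<Sum>x\<in>UNIV. \<alpha> (Node Leaf x Leaf)) +
      (\<Sum>x\<in>UNIV. tree_fps (\<lambda>T. \<alpha> (Node T x Leaf)) + tree_fps (\<lambda>T. \<alpha> (Node Leaf x T))) +
      tree_fps \<alpha> * tree_fps w)) $ n"
  proof (cases n)
    case (Suc k)
    have "(\<Sum>i\<le>k. tree_sum (\<lambda>_. 1) \<alpha> i * tree_sum (\<lambda>_. 1) w (k - i)) = (tree_fps \<alpha> * tree_fps w) $ k"
      by (simp add: tree_fps_def fps_mult_nth atMost_atLeast0)
    with Suc show ?thesis
      using tree_sum_Suc[OF assms, of "\<lambda>_. 1" "\<lambda>_ _. 1" k]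
      by (simp add: tree_fps_def[of \<alpha>] fps_sum_nth) (simp add: tree_fps_def)
  qed simp
qed

text \<open>
  The factor \<open>fps_X\<close> makes the coefficient of index \<open>n + 1\<close> depend only on coefficients up to
  index \<open>n\<close>, for the next value of the parameter.
\<close>

lemma fps_shift_recursion_unique:
  fixes Y Z :: "nat \<Rightarrow> 'a::comm_ring_1 fps"
  assumes "\<And>s. Y s = fps_X * (M * (fps_const (u s) + Y (Suc s)))"
    and "\<And>s. Z s = fps_X * (M * (fps_const (u s) + Z (Suc s)))"
  shows "Y s = Z s"
proof -
  have "Y s $ n = Z s $ n" for n
  proof (induction n arbitrary: s rule: less_induct)
    case (less n)
    show ?case
    proof (cases n)
      case 0
      then show ?thesis by (subst assms(1), subst assms(2)) simp
    next
      case (Suc k)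
      then have "(M * (fps_const (u s) + Y (Suc s))) $ k = (M * (fps_const (u s) + Z (Suc s))) $ k"
        unfolding fps_mult_nth using less.IH by (intro sum.cong) auto
      with Suc show ?thesis by (subst assms(1), subst assms(2)) simp
    qed
  qed
  then show ?thesis by (simp add: fps_ext)
qed

text \<open>
  The functional equation \<open>M(z) = C(z M(z))\<close> between the moment series and the series
  \<open>C = 1 + u 1 * z + u 2 * z\<^sup>2 + \<dots>\<close> of free cumulants. The shifted moment series, without constant
  term, and the shifted cumulant series composed with \<open>z M(z)\<close> satisfy the same recursion in the shift.
\<close>

lemma free_moment_fps:
  fixes u :: "nat \<Rightarrow> 'a::field"
  defines "M \<equiv> Abs_fps (free_moment u 0)"
  shows "M = 1 + (Abs_fps (\<lambda>j. if j = 0 then 0 else u j) oo (fps_X * M))"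
proof -
  define G where "G s = Abs_fps (\<lambda>n. if n = 0 then 0 else free_moment u s n)" for s
  define C where "C s = Abs_fps (\<lambda>j. if j = 0 then 0 else u (s + j))" for s
  have "G s = fps_X * (M * (fps_const (u (Suc s)) + G (Suc s)))" for s
  proof (rule fps_ext)
    fix n
    show "G s $ n = (fps_X * (M * (fps_const (u (Suc s)) + G (Suc s)))) $ n"
    proof (cases n)
      case (Suc k)
      have "(M * G (Suc s)) $ k = (\<Sum>j\<le>k. free_moment u 0 j * G (Suc s) $ (k - j))"
        by (simp add: M_def fps_mult_nth atMost_atLeast0)
      also have "\<dots> = (\<Sum>j<k. free_moment u 0 j * free_moment u (Suc s) (k - j))"
        by (simp add: lessThan_Suc_atMost[symmetric] G_def)
      finally show ?thesis
        using Suc by (simp add: distrib_left M_def) (simp add: G_def M_def)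
    qed (simp add: G_def)
  qed
  moreover have "C s oo (fps_X * M) =
      fps_X * (M * (fps_const (u (Suc s)) + (C (Suc s) oo (fps_X * M))))" for s
  proof -
    have "C s = fps_X * (fps_const (u (Suc s)) + C (Suc s))"
    proof (rule fps_ext)
      fix n
      show "C s $ n = (fps_X * (fps_const (u (Suc s)) + C (Suc s))) $ n"
        by (cases n) (auto simp: C_def)
    qed
    then have "C s oo (fps_X * M) = (fps_X * (fps_const (u (Suc s)) + C (Suc s))) oo (fps_X * M)"
      by simp
    then show ?thesis
      by (simp add: fps_compose_mult_distrib fps_compose_add_distrib mult.assoc)
  qed
  ultimately have G0: "G 0 = C 0 oo (fps_X * M)"
    by (rule fps_shift_recursion_unique)
  have C0: "C 0 = Abs_fps (\<lambda>j. if j = 0 then 0 else u j)"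
    by (simp add: C_def cong: if_cong)
  show ?thesis
    unfolding C0[symmetric] G0[symmetric] by (rule fps_ext) (simp add: M_def G_def)
qed

text \<open>
  Write \<open>K \<alpha>\<close> for the ordinary generating function of nonempty trees with weight \<open>\<alpha>\<close>, composed with
  \<open>z M(z)\<close>. The hypothesis on \<open>M\<close> says \<open>M * (1 + z * w Leaf + z * K w) = 1\<close>. Multiplying \<open>K \<alpha>\<close> by
  this \<open>1\<close> produces a term \<open>z * M * K \<alpha> * K w\<close>, which cancels against the quadratic term of the root
  decomposition of \<open>K \<alpha>\<close>. The result is the recursion of the convolution of \<open>D \<alpha>\<close> with the
  moments, with \<open>M * K \<alpha>\<close> in its place.
\<close>

lemma tree_fps_compose_recursion:
  fixes \<alpha> w :: "'c::finite tree \<Rightarrow> 'a::field" and M :: "'a fps"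
  assumes mult: "right_multiplicative b w \<alpha>"
    and M: "M = 1 - fps_X * M * (fps_const (w Leaf) + (tree_fps w oo (fps_X * M)))"
  defines "L \<equiv> \<lambda>\<beta>. M * (tree_fps \<beta> oo (fps_X * M))"
  shows "L \<alpha> = fps_X * (fps_const (\<Sum>x\<in>UNIV. \<alpha> (Node Leaf x Leaf)) * M +
      (\<Sum>x\<in>UNIV. L (\<lambda>T. \<alpha> (Node T x Leaf)) + L (\<lambda>T. \<alpha> (Node Leaf x T))) -
      fps_const (w Leaf) * L \<alpha>)"
proof -
  let ?z = "fps_X :: 'a fps"
  let ?K = "\<lambda>\<beta>. tree_fps \<beta> oo (?z * M)"
  let ?A = "fps_const (\<Sum>x\<in>UNIV. \<alpha> (Node Leaf x Leaf))"
  let ?S = "\<Sum>x\<in>UNIV. ?K (\<lambda>T. \<alpha> (Node T x Leaf)) + ?K (\<lambda>T. \<alpha> (Node Leaf x T))"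
  have "?K \<alpha> = (?z * (?A + (\<Sum>x\<in>UNIV. tree_fps (\<lambda>T. \<alpha> (Node T x Leaf)) + tree_fps (\<lambda>T. \<alpha> (Node Leaf x T))) +
      tree_fps \<alpha> * tree_fps w)) oo (?z * M)"
    using tree_fps_eq[OF mult] by simp
  then have K: "?K \<alpha> = ?z * M * (?A + ?S + ?K \<alpha> * ?K w)"
    by (simp add: fps_compose_mult_distrib fps_compose_add_distrib fps_compose_sum_distrib)
  have one: "M * (1 + ?z * fps_const (w Leaf) + ?z * ?K w) = 1"
    using M by (simp add: algebra_simps)
  have "?K \<alpha> * (M * (1 + ?z * fps_const (w Leaf) + ?z * ?K w)) = ?z * M * (?A + ?S + ?K \<alpha> * ?K w)"
    unfolding one using K by simp
  then have "M * ?K \<alpha> = ?z * (?A * M + M * ?S - fps_const (w Leaf) * (M * ?K \<alpha>))"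
    by (simp add: algebra_simps)
  then show ?thesis
    by (simp add: L_def sum_distrib_left distrib_left)
qed


section \<open>Comparison of the moments\<close>

text \<open>
  The recursions from the two sides determine, from the same initial values, the moments together
  with the auxiliary sequences for all \<open>\<alpha>\<close> simultaneously.
\<close>

theorem moments_of_multiplicative_weight:
  fixes w :: "'c::finite tree \<Rightarrow> 'a::field"
  assumes mult: "right_multiplicative b w w"
    and \<kappa>: "\<And>n. \<kappa> (Suc n) = - (\<Sum>T | size T = n. w T)"
    and c: "\<And>n. c (Suc n) = - (\<Sum>T | size T = n. of_nat (num_decreasing_labelings T) * w T)"
  shows "classical_moment c n = free_moment \<kappa> 0 n"
proof -
  define m where "m = classical_moment c"
  define M where "M = Abs_fps (free_moment \<kappa> 0)"
  have 0: "{T :: 'c tree. size T = 0} = {Leaf}" by auto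
  have c': "c (Suc k) = - ((if k = 0 then w Leaf else 0) + tree_sum labeling_count w k)" for k
    using c[of k] 0 by (simp add: tree_sum_def)
  have m: "m (Suc n) = - (w Leaf * m n + (tree_sum labeling_count w \<star> m) n)" for n
  proof -
    have "m (Suc n) = ((\<lambda>k. c (Suc k)) \<star> m) n"
      by (simp add: m_def binomial_convolution_def)
    then show ?thesis
      by (simp only: c' binomial_convolution_minus_left binomial_convolution_add_left
          binomial_convolution_delta_left)
  qed
  have M: "M = 1 - fps_X * M * (fps_const (w Leaf) + (tree_fps w oo (fps_X * M)))"
  proof -
    have "Abs_fps (\<lambda>j. if j = 0 then 0 else \<kappa> j) = - (fps_X * (fps_const (w Leaf) + tree_fps w))"
    proof (rule fps_ext)
      fix n
      show "Abs_fps (\<lambda>j. if j = 0 then 0 else \<kappa> j) $ n = (- (fps_X * (fps_const (w Leaf) + tree_fps w))) $ n"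
        using \<kappa> 0 by (cases n) (simp_all add: tree_fps_def tree_sum_def)
    qed
    then have "M = 1 + ((- (fps_X * (fps_const (w Leaf) + tree_fps w))) oo (fps_X * M))"
      using free_moment_fps[of \<kappa>] by (simp add: M_def)
    then show ?thesis
      by (simp add: fps_compose_uminus fps_compose_mult_distrib fps_compose_add_distrib)
  qed
  define L where "L \<beta> = M * (tree_fps \<beta> oo (fps_X * M))" for \<beta> :: "'c tree \<Rightarrow> 'a"
  have L: "L \<alpha> $ Suc n = (\<Sum>x\<in>UNIV. \<alpha> (Node Leaf x Leaf)) * M $ n +
      (\<Sum>x\<in>UNIV. L (\<lambda>T. \<alpha> (Node T x Leaf)) $ n + L (\<lambda>T. \<alpha> (Node Leaf x T)) $ n) -
      w Leaf * L \<alpha> $ n" if "right_multiplicative b w \<alpha>" for \<alpha> n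
    by (subst L_def, subst tree_fps_compose_recursion[OF that M], fold L_def) (simp add: fps_sum_nth)
  have M': "M $ Suc n = - (w Leaf * M $ n + L w $ n)" for n
    by (subst M) (simp add: L_def algebra_simps)
  have "m n = M $ n \<and>
      (\<forall>\<alpha>. right_multiplicative b w \<alpha> \<longrightarrow> (tree_sum labeling_count \<alpha> \<star> m) n = L \<alpha> $ n)"
  proof (induction n)
    case 0
    show ?case by (simp add: m_def M_def L_def)
  next
    case (Suc n)
    then have IH: "m n = M $ n"
      "\<And>\<alpha>. right_multiplicative b w \<alpha> \<Longrightarrow> (tree_sum labeling_count \<alpha> \<star> m) n = L \<alpha> $ n"
      by simp_all
    have "m (Suc n) = M $ Suc n"
      using IH(1) IH(2)[OF mult] by (simp add: m M')
    moreover have "(tree_sum labeling_count \<alpha> \<star> m) (Suc n) = L \<alpha> $ Suc n"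
      if "right_multiplicative b w \<alpha>" for \<alpha>
      unfolding labeling_convolution_recursion[OF that m] L[OF that]
      by (simp only: IH(1) IH(2)[OF that] IH(2)[OF right_multiplicative_left[OF that]]
          IH(2)[OF right_multiplicative_right[OF that]])
    ultimately show ?case by blast
  qed
  then show ?thesis by (simp add: m_def M_def)
qed

text \<open>
  A tree \<open>insertion b v T1 T2\<close> has a black vertex with two children at \<open>v\<close>, and decomposing there gives
  back \<open>T1\<close> and \<open>T2\<close>. Hence by both closure properties of a troupe it belongs to the troupe exactly if
  \<open>T1\<close> and \<open>T2\<close> do, so that extending the weight by zero keeps it multiplicative.
\<close>

lemma troupe_weight_right_multiplicative:
  fixes b :: 'c and TT :: "'c tree set"
  assumes "troupe b TT" and additive: "\<forall>i\<in>{1..r}. insertion_additive b (f i)"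
  defines "w \<equiv> \<lambda>T. if T \<in> TT then \<Prod>i = 1..r. xpow i (f i T) else 0"
  shows "right_multiplicative b w w"
  unfolding right_multiplicative_def
proof (intro conjI allI ballI impI)
  have ins: "insertion b v T1 T2 \<in> TT"
    if "T1 \<in> TT" "T2 \<in> TT" "T1 \<noteq> Leaf" "T2 \<noteq> Leaf" "v \<in> vertices T1" for T1 T2 v
    using assms(1) that unfolding troupe_def by simp
  have dec: "decomposition v T \<in> TT \<times> TT"
    if "T \<in> TT" "v \<in> vertices T" "two_children T v" "color_at T v = b" for T v
    using assms(1) that unfolding troupe_def by simp
  fix T1 T2 :: "'c tree" and v assume v: "v \<in> vertices T1" and T2: "T2 \<noteq> Leaf"
  let ?T = "insertion b v T1 T2"
  have T1: "T1 \<noteq> Leaf" using v by (rule vertices_nonempty)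
  have "two_children ?T v" "color_at ?T v = b"
    using v T2 by (simp_all add: two_children_def color_at_def subtree_at_insertion vertices_def)
  then have "?T \<in> TT \<longleftrightarrow> T1 \<in> TT \<and> T2 \<in> TT"
    using ins[OF _ _ T1 T2 v] dec[of ?T v] vertex_of_insertion[OF v]
    by (auto simp: decomposition_insertion[OF v])
  moreover have "xpow i (f i ?T) = xpow i (f i T1) * xpow i (f i T2)" if "i \<in> {1..r}" for i
    using additive that v T1 T2 by (simp add: insertion_additive_def xpow_add)
  then have "(\<Prod>i = 1..r. xpow i (f i ?T)) = (\<Prod>i = 1..r. xpow i (f i T1)) * (\<Prod>i = 1..r. xpow i (f i T2))"
    by (simp add: prod.distrib)
  ultimately show "w ?T = w T1 * w T2" by (simp add: w_def)
next
  fix T :: "'c tree" and v assume "v \<in> vertices T" "two_children T v" "color_at T v \<noteq> b"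
  then have "T \<notin> TT" using assms(1) unfolding troupe_def by blast
  then show "w T = 0" by (simp add: w_def)
qed

theorem theorem6p1:
  fixes black white :: "'c::finite"
    and TT :: "'c tree set"
    and r :: nat
    and f :: "nat \<Rightarrow> 'c tree \<Rightarrow> complex"
    and \<kappa> c :: "nat \<Rightarrow> ratfun"
  assumes "black \<noteq> white"
    and "troupe black TT"
    and "\<forall>i\<in>{1..r}. insertion_additive black (f i)"
    and "\<forall>n\<ge>1. \<kappa> n = - (\<Sum>T\<in>trees_of_size TT (n - 1). \<Prod>i = 1..r. xpow i (f i T))"
  shows "cumulants_correspond \<kappa> c \<longleftrightarrow>
    (\<forall>n\<ge>1. c n = - (\<Sum>t\<in>decreasing_trees_of_size TT (n - 1). \<Prod>i = 1..r. xpow i (f i (skel t))))"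
proof -
  define w where "w = (\<lambda>T. if T \<in> TT then \<Prod>i = 1..r. xpow i (f i T) else 0)"
  define d where "d n = - (\<Sum>t\<in>decreasing_trees_of_size TT (n - 1). \<Prod>i = 1..r. xpow i (f i (skel t)))" for n
  have "\<kappa> (Suc n) = - (\<Sum>T | size T = n. w T)" for n
  proof -
    have "(\<Sum>T\<in>trees_of_size TT n. \<Prod>i = 1..r. xpow i (f i T)) = (\<Sum>T | size T = n. w T)"
      by (intro sum.mono_neutral_cong_left finite_trees_of_size) (auto simp: trees_of_size_def w_def)
    then show ?thesis using assms(4) by simp
  qed
  moreover have "d (Suc n) = - (\<Sum>T | size T = n. of_nat (num_decreasing_labelings T) * w T)" for n
    using sum_decreasing_trees_of_size[of "\<lambda>T. \<Prod>i = 1..r. xpow i (f i T)" TT n]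
    by (simp add: d_def w_def)
  ultimately have moments: "classical_moment d n = free_moment \<kappa> 0 n" for n
    using troupe_weight_right_multiplicative[OF assms(2,3)]
    by (intro moments_of_multiplicative_weight[of black w]) (simp_all add: w_def)
  \<comment> \<open>both moments of index \<open>0\<close> are \<open>1\<close>, so the range of \<open>n\<close> does not matter\<close>
  have "cumulants_correspond \<kappa> c \<longleftrightarrow> (\<forall>n\<ge>1. classical_moment c n = free_moment \<kappa> 0 n)"
    unfolding cumulants_correspond_def sum_set_partitions sum_NC by auto
  also have "\<dots> \<longleftrightarrow> (\<forall>n. classical_moment c n = classical_moment d n)"
    by (metis moments classical_moment.simps(1) less_one linorder_not_less)
  also have "\<dots> \<longleftrightarrow> (\<forall>n. c (Suc n) = d (Suc n))"
    using classical_moment_inject classical_moment_cong by metis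
  also have "\<dots> \<longleftrightarrow> (\<forall>n\<ge>1. c n = d n)"
    by (metis Suc_le_D One_nat_def le_add1 plus_1_eq_Suc)
  finally show ?thesis by (simp only: d_def)
qed

end
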